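(* Let $A_1,\dots,A_k$ be zero-diagonal Hermitian $n\times n$ matrices, and let $\Lambda$ be the set of distinct roots of $q=\chi[A_1,\dots,A_k]$. For each $j\in\{1,\dots,k\}$ there are Hermitian positive semidefinite matrices $W_\lambda^{(j)}\succeq0$, $\lambda\in\Lambda$, satisfying $$\sum_{\lambda\in\Lambda} W_\lambda^{(j)}=I,\qquad \sum_{\lambda\in\Lambda}\lambda W_\lambda^{(j)}=\frac{A_j}{k},\qquad \sum_{\lambda\in\Lambda}\lambda^2W_\lambda^{(j)}=\frac{A_j^2+\sum_{i\ne j}\operatorname{diag}(A_i^2)}{k^2}.$$ Furthermore, with $H_m^{(j)}:=\sum_{\lambda\in\Lambda}\lambda^mW_\lambda^{(j)}$, it holds that $$H_2^{(j)}-(H_1^{(j)})^2=\frac1{k^2}\sum_{i\ne j}\operatorname{diag}(A_i^2).$$ If $A_1,\dots,A_k$ are real symmetric, the matrices $W_\lambda^{(j)}$ may be chosen real symmetric.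
   Context: For a square matrix $B$, $\operatorname{diag}(B)$ denotes the diagonal matrix with the same diagonal as $B$. For $S\subseteq[n]$, $A[S]$ is the principal submatrix indexed by $S$ (the characteristic polynomial of the empty submatrix is $1$). For Hermitian $n\times n$ matrices $A_1,\dots,A_k$ the normalized mixed determinantal polynomial is $$\chi[A_1,\dots,A_k](x)=k^{-n}\sum_{S_1\sqcup\cdots\sqcup S_k=[n]}\ \prod_{j=1}^k\det(xI-A_j[S_j]),$$ the sum being over ordered partitions of $[n]$ into $k$ possibly empty parts; it is monic of degree $n$ and real-rooted. *)

theory Defs
  imports
    "Jordan_Normal_Form.Char_Poly"
    "Jordan_Normal_Form.DL_Submatrix"
    "Jordan_Normal_Form.Schur_Decomposition"
    "HOL-Library.FuncSet"
    "HOL-Library.Disjoint_Sets"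
begin

text \<open>Matrix rows and columns are indexed from 0, so the index set $[n]$ is \<open>{..<n}\<close>;
  the matrices of a family are indexed by \<open>{1..k}\<close>.\<close>

definition hermitian_mat :: "nat \<Rightarrow> complex mat \<Rightarrow> bool" where
  "hermitian_mat n A \<longleftrightarrow> A \<in> carrier_mat n n \<and> mat_adjoint A = A"

text \<open>The scalar product \<open>(A *\<^sub>v v) \<bullet>c v\<close> conjugates its second argument, so it is $v^* A v$,
  which is real for Hermitian \<open>A\<close>.\<close>

definition psd_mat :: "nat \<Rightarrow> complex mat \<Rightarrow> bool" where
  "psd_mat n A \<longleftrightarrow> hermitian_mat n A \<and> (\<forall>v\<in>carrier_vec n. 0 \<le> Re ((A *\<^sub>v v) \<bullet>c v))"

definition real_symmetric_mat :: "nat \<Rightarrow> complex mat \<Rightarrow> bool" where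
  "real_symmetric_mat n A \<longleftrightarrow> A \<in> carrier_mat n n \<and> A\<^sup>T = A \<and> (\<forall>i<n. \<forall>j<n. A $$ (i, j) \<in> \<real>)"

definition zero_diagonal :: "'a::zero mat \<Rightarrow> bool" where
  "zero_diagonal A \<longleftrightarrow> (\<forall>i<dim_row A. A $$ (i, i) = 0)"

definition diag_part :: "'a::zero mat \<Rightarrow> 'a mat" where
  "diag_part B = mat_diag (dim_row B) (\<lambda>i. B $$ (i, i))"

text \<open>Matrices of variable dimension do not form a type class monoid, so \<open>sum\<close> is not
  available for them; this is the sum of the \<open>n \<times> n\<close> matrices \<open>F x\<close> over \<open>x \<in> X\<close>.\<close>

definition mat_sum :: "nat \<Rightarrow> ('b \<Rightarrow> 'a::comm_monoid_add mat) \<Rightarrow> 'b set \<Rightarrow> 'a mat" where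
  "mat_sum n F X = mat n n (\<lambda>ij. \<Sum>x\<in>X. F x $$ ij)"

definition ordered_partitions :: "nat \<Rightarrow> nat \<Rightarrow> (nat \<Rightarrow> nat set) set" where
  "ordered_partitions n k =
     {S \<in> {1..k} \<rightarrow>\<^sub>E Pow {..<n}. disjoint_family_on S {1..k} \<and> (\<Union>j\<in>{1..k}. S j) = {..<n}}"

definition mixed_det_poly :: "nat \<Rightarrow> nat \<Rightarrow> (nat \<Rightarrow> complex mat) \<Rightarrow> complex poly" where
  "mixed_det_poly n k A =
     smult (1 / of_nat k ^ n)
       (\<Sum>S\<in>ordered_partitions n k. \<Prod>j\<in>{1..k}. char_poly (submatrix (A j) (S j) (S j)))"

definition weighted_moment :: "nat \<Rightarrow> complex set \<Rightarrow> (complex \<Rightarrow> complex mat) \<Rightarrow> nat \<Rightarrow> complex mat" where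
  "weighted_moment n \<Lambda> W m = mat_sum n (\<lambda>l. l ^ m \<cdot>\<^sub>m W l) \<Lambda>"

end

theory Submission
  imports Defs "HOL-Computational_Algebra.Fundamental_Theorem_Algebra" "HOL-Combinatorics.Permutations"
begin

text \<open>Averaging over colourings \<open>c : [n] \<rightarrow> [k]\<close>, $q$ is the mean of $\prod_i \det(xI - A_i[c^{-1}(i)])$.
  Such a sum does not vanish when each \<open>xI - A_i\<close> is replaced by a matrix whose imaginary part is positive
  definite; hence $q$ is real-rooted. Replacing \<open>A_j\<close> by \<open>A_j + w v v\<^sup>*\<close> changes $q$ by $-w\,v^* N v$ with a
  matrix \<open>N(x)\<close> of polynomials (averaged adjugates), so nonvanishing for \<open>Im x > 0\<close>, \<open>Im w \<le> 0\<close> means that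
  \<open>v\<^sup>* N v / q\<close> maps the upper half-plane to the closed lower one. Therefore \<open>N / q\<close> has only simple
  poles, with positive semidefinite residues; \<open>k\<close> times these residues are the matrices \<open>W\<close>. Their
  moments are the coefficients of \<open>k N / q\<close> at \<open>x = \<infinity>\<close>, obtained from the adjugate identity and from the
  independence of the colours.\<close>

section \<open>Determinants as functions of the rows\<close>

text \<open>As \<open>q\<close> may have multiple roots, simple poles are not automatic. They and
  the positivity come from signs alone: if c / z^d maps the upper half-plane into the closed lower
  one, then d = 1 and c >= 0. This sign is known only for the forms v^* N v; polarization carries
  the divisibility over to single entries. The factor k is 1 / P(c(b) = j), since an index b enters
  the adjugate of the j-th factor only if it has colour j. In the second moment, A_j(a,l) A_j(l,b)
  needs colour j at a, l and b: three independent choices off the diagonal, but only two if a = b.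
  On the diagonal the surplus is offset by the correlation between c(b) = j and the second-order
  coefficient of the whole product; what remains is the sum of the diagonals of all A_i^2, which is
  where the terms with i different from j come from. Zero diagonals of the A_i make all first-order
  coefficients of the minors vanish, so no further cross terms appear. For real symmetric A_i,
  entrywise real parts of the weights serve: roots and right-hand sides are real, and real parts of
  a positive semidefinite matrix are again positive semidefinite.\<close>

definition row_det :: "nat \<Rightarrow> (nat \<Rightarrow> nat \<Rightarrow> 'a) \<Rightarrow> 'a::comm_ring_1" where
  "row_det n r = det (mat n n (\<lambda>(a, b). r a b))"

definition unit_row :: "nat \<Rightarrow> nat \<Rightarrow> 'a::comm_ring_1" where
  "unit_row a b = of_bool (a = b)"

text \<open>Rows outside \<open>S\<close> are replaced by rows of the identity matrix, so that \<open>row_det n (row_mask S r)\<close>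
  is the principal minor indexed by \<open>S\<close>; it is moreover a determinant of the fixed size \<open>n\<close>.\<close>

definition row_mask :: "nat set \<Rightarrow> (nat \<Rightarrow> nat \<Rightarrow> 'a) \<Rightarrow> nat \<Rightarrow> nat \<Rightarrow> 'a::comm_ring_1" where
  "row_mask S r a = (if a \<in> S then r a else unit_row a)"

lemma row_det_leibniz:
  "row_det n r = (\<Sum>p | p permutes {..<n}. of_int (sign p) * (\<Prod>a<n. r a (p a)))"
proof -
  have "row_det n r = (\<Sum>p | p permutes {0..<n}. of_int (sign p) * (\<Prod>a = 0..<n. mat n n (\<lambda>(a, b). r a b) $$ (a, p a)))"
    unfolding row_det_def det_def by simp
  also have "\<dots> = (\<Sum>p | p permutes {0..<n}. of_int (sign p) * (\<Prod>a = 0..<n. r a (p a)))"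
    by (intro sum.cong refl arg_cong2[where f = "(*)"] prod.cong)
       (use permutes_in_image in fastforce)
  finally show ?thesis by (simp add: lessThan_atLeast0)
qed

lemma row_det_cong:
  assumes "\<And>a b. a < n \<Longrightarrow> b < n \<Longrightarrow> r a b = s a b"
  shows "row_det n r = row_det n s"
  unfolding row_det_def by (intro arg_cong[where f = det] cong_mat) (use assms in auto)

text \<open>Every Leibniz term uses exactly one entry of row \<open>b\<close>, so multilinearity in
  that row reduces to distributivity.\<close>

lemma row_det_upd:
  assumes "b < n"
  shows "row_det n (r(b := w)) =
    (\<Sum>p | p permutes {..<n}. of_int (sign p) * (w (p b) * (\<Prod>a\<in>{..<n} - {b}. r a (p a))))"
proof -
  have "(\<Prod>a<n. (r(b := w)) a (p a)) = w (p b) * (\<Prod>a\<in>{..<n} - {b}. r a (p a))" for p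
    using assms by (subst prod.remove[of _ b]) auto
  then show ?thesis unfolding row_det_leibniz by simp
qed

lemma row_det_linear:
  assumes "b < n"
  shows "row_det n (r(b := \<lambda>l. \<Sum>i\<in>J. f i * w i l)) = (\<Sum>i\<in>J. f i * row_det n (r(b := w i)))"
  unfolding row_det_upd[OF assms] sum_distrib_right sum_distrib_left
  by (subst sum.swap) (simp add: mult_ac)

lemma row_det_add:
  assumes "b < n"
  shows "row_det n (r(b := \<lambda>l. u l + z * w l)) = row_det n (r(b := u)) + z * row_det n (r(b := w))"
  unfolding row_det_upd[OF assms] sum_distrib_left sum.distrib[symmetric]
  by (intro sum.cong refl) (simp add: algebra_simps)

lemma row_det_equal_rows:
  assumes "a < n" "b < n" "a \<noteq> b" "\<And>l. l < n \<Longrightarrow> r a l = r b l"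
  shows "row_det n r = 0"
  unfolding row_det_def
  by (rule det_identical_rows[of _ n a b]) (use assms in \<open>auto intro!: eq_vecI\<close>)

lemma row_det_unit [simp]: "row_det n unit_row = 1"
proof -
  have "mat n n (\<lambda>(a, b). unit_row a b) = (1\<^sub>m n :: 'a mat)"
    by (rule eq_matI) (auto simp: unit_row_def)
  then show ?thesis unfolding row_det_def by simp
qed

lemma row_det_poly: "poly (row_det n R) x = row_det n (\<lambda>a b. poly (R a b) x)"
  unfolding row_det_leibniz by (simp add: poly_sum poly_prod)

lemma row_det_degree:
  assumes "\<And>a b. a < n \<Longrightarrow> b < n \<Longrightarrow> degree (R a b) \<le> d a"
  shows "degree (row_det n R) \<le> (\<Sum>a<n. d a)"
proof -
  have "degree (of_int (sign p) * (\<Prod>a<n. R a (p a))) \<le> (\<Sum>a<n. d a)" if p: "p permutes {..<n}" for p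
  proof -
    have "degree (\<Prod>a<n. R a (p a)) \<le> (\<Sum>a<n. degree (R a (p a)))"
      using degree_prod_sum_le[of "{..<n}" "\<lambda>a. R a (p a)"] by (simp add: o_def)
    also have "\<dots> \<le> (\<Sum>a<n. d a)"
      using assms permutes_in_image[OF p] by (intro sum_mono) auto
    finally show ?thesis by (cases p rule: sign_cases) auto
  qed
  then show ?thesis unfolding row_det_leibniz by (intro degree_sum_le) (auto simp: finite_permutations)
qed

lemma row_det_0_kernel:
  fixes r :: "nat \<Rightarrow> nat \<Rightarrow> 'a::field"
  assumes "row_det n r = 0"
  obtains v where "\<exists>a<n. v a \<noteq> 0" "\<And>a. a < n \<Longrightarrow> (\<Sum>b<n. r a b * v b) = 0"
proof -
  let ?M = "mat n n (\<lambda>(a, b). r a b)"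
  obtain v where v: "v \<in> carrier_vec n" "v \<noteq> 0\<^sub>v n" "?M *\<^sub>v v = 0\<^sub>v n"
    using assms det_0_iff_vec_prod_zero_field[of ?M n] unfolding row_det_def by auto
  have 1: "\<exists>a<n. v $ a \<noteq> 0"
  proof (rule ccontr)
    assume "\<not> ?thesis"
    then have "v = 0\<^sub>v n" using v(1) by (intro eq_vecI) auto
    with v show False by simp
  qed
  have 2: "(\<Sum>b<n. r a b * v $ b) = 0" if "a < n" for a
  proof -
    have "(?M *\<^sub>v v) $ a = (\<Sum>b<n. r a b * v $ b)"
      using that v(1) by (simp add: scalar_prod_def lessThan_atLeast0)
    then show ?thesis using v(3) that by simp
  qed
  show ?thesis using that[of "\<lambda>a. v $ a"] 1 2 by blast
qed

text \<open>Row \<open>i\<close> equals \<open>w\<close>, so the multiples of \<open>w\<close> in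
  the rows of \<open>J\<close> can be removed one at a time: by linearity each leaves a determinant
  with two rows equal to \<open>w\<close>.\<close>

lemma row_det_rank_one_upd:
  assumes "finite J" "J \<subseteq> {..<n}" "i < n" "i \<notin> J"
  shows "row_det n ((\<lambda>a. if a \<in> J then \<lambda>l. r a l + u a * w l else r a)(i := w)) = row_det n (r(i := w))"
  using assms
proof (induction J rule: finite_induct)
  case (insert m J)
  let ?s = "(\<lambda>a. if a \<in> J then \<lambda>l. r a l + u a * w l else r a)(i := w)"
  have "(\<lambda>a. if a \<in> insert m J then \<lambda>l. r a l + u a * w l else r a)(i := w) = ?s(m := \<lambda>l. r m l + u m * w l)"
    using insert.prems by auto
  moreover have "?s(m := r m) = ?s" using insert by auto
  moreover have "row_det n (?s(m := w)) = 0"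
    by (rule row_det_equal_rows[of m _ i]) (use insert.prems in auto)
  moreover have "row_det n (?s(m := \<lambda>l. r m l + u m * w l)) = row_det n (?s(m := r m)) + u m * row_det n (?s(m := w))"
    using insert.prems by (intro row_det_add) auto
  moreover have "row_det n ?s = row_det n (r(i := w))" using insert by blast
  ultimately show ?case by (simp only: mult_zero_right add_0_right)
qed simp

text \<open>The matrix determinant lemma without inverses: expanding row by row, every term with two
  copies of \<open>w\<close> vanishes, so the determinant is affine in \<open>u\<close>. It holds
  over any commutative ring and for singular matrices.\<close>

lemma row_det_rank_one:
  "row_det n (\<lambda>a l. r a l + u a * w l) = row_det n r + (\<Sum>b<n. u b * row_det n (r(b := w)))"
proof -
  have "row_det n (\<lambda>a. if a \<in> J then \<lambda>l. r a l + u a * w l else r a)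
      = row_det n r + (\<Sum>b\<in>J. u b * row_det n (r(b := w)))" if "finite J" "J \<subseteq> {..<n}" for J
    using that
  proof (induction J rule: finite_induct)
    case (insert i J)
    let ?s = "\<lambda>a. if a \<in> J then \<lambda>l. r a l + u a * w l else r a"
    have "(\<lambda>a. if a \<in> insert i J then \<lambda>l. r a l + u a * w l else r a) = ?s(i := \<lambda>l. r i l + u i * w l)"
      by auto
    moreover have "?s(i := r i) = ?s" using insert by auto
    moreover have "row_det n (?s(i := w)) = row_det n (r(i := w))"
      using insert by (intro row_det_rank_one_upd) auto
    moreover have "row_det n (?s(i := \<lambda>l. r i l + u i * w l)) = row_det n (?s(i := r i)) + u i * row_det n (?s(i := w))"
      using insert.prems by (intro row_det_add) auto
    moreover have "row_det n ?s = row_det n r + (\<Sum>b\<in>J. u b * row_det n (r(b := w)))"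
      using insert by blast
    ultimately show ?case by (simp only: sum.insert[OF insert.hyps] add_ac)
  qed simp
  from this[of "{..<n}"] have "row_det n (\<lambda>a. if a \<in> {..<n} then \<lambda>l. r a l + u a * w l else r a)
      = row_det n r + (\<Sum>b<n. u b * row_det n (r(b := w)))" by simp
  moreover have "row_det n (\<lambda>a. if a \<in> {..<n} then \<lambda>l. r a l + u a * w l else r a)
     = row_det n (\<lambda>a l. r a l + u a * w l)" by (rule row_det_cong) auto
  ultimately show ?thesis by simp
qed

text \<open>Replacing row \<open>b\<close> by the unit row at \<open>l\<close> gives the (l, b)
  entry of the adjugate, so this is the product of a matrix with its adjugate, read
  entrywise.\<close>

lemma adjugate_identity:
  assumes "a < n" "b < n"
  shows "(\<Sum>l<n. r a l * row_det n (r(b := unit_row l))) = (if a = b then row_det n r else 0)"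
proof -
  have "(\<Sum>l<n. r a l * row_det n (r(b := unit_row l))) = row_det n (r(b := \<lambda>m. \<Sum>l<n. r a l * unit_row l m))"
    by (rule row_det_linear[OF assms(2), symmetric])
  also have "\<dots> = row_det n (r(b := r a))"
    by (rule row_det_cong) (auto simp: unit_row_def)
  also have "\<dots> = (if a = b then row_det n r else 0)"
  proof (cases "a = b")
    case False
    then have "row_det n (r(b := r a)) = 0"
      using assms by (intro row_det_equal_rows[of a _ b]) auto
    then show ?thesis using False by simp
  qed simp
  finally show ?thesis .
qed

section \<open>Nonvanishing of sums over colourings\<close>

definition herm_form :: "nat \<Rightarrow> (nat \<Rightarrow> nat \<Rightarrow> complex) \<Rightarrow> (nat \<Rightarrow> complex) \<Rightarrow> complex" where
  "herm_form n M v = (\<Sum>a<n. \<Sum>b<n. cnj (v a) * M a b * v b)"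

definition positive_imaginary :: "nat \<Rightarrow> (nat \<Rightarrow> nat \<Rightarrow> complex) \<Rightarrow> bool" where
  "positive_imaginary n C \<longleftrightarrow> (\<forall>v. (\<exists>a<n. v a \<noteq> 0) \<longrightarrow> 0 < Im (herm_form n C v))"

text \<open>The indices in \<open>U\<close> occur in every factor. They are the ones whose colour has not been chosen
  yet: moving an index from \<open>U\<close> to \<open>T\<close> takes the subleading coefficient of a polynomial of
  degree \<open>card K\<close>, a nonzero multiple of the sum of its roots.\<close>

definition colour_sum :: "nat \<Rightarrow> nat set \<Rightarrow> nat set \<Rightarrow> nat set \<Rightarrow> (nat \<Rightarrow> nat \<Rightarrow> nat \<Rightarrow> 'a) \<Rightarrow> 'a::comm_ring_1" where
  "colour_sum n K T U C = (\<Sum>c\<in>T \<rightarrow>\<^sub>E K. \<Prod>i\<in>K. row_det n (row_mask ({a \<in> T. c a = i} \<union> U) (C i)))"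

text \<open>A kernel vector vanishes at indices outside \<open>S\<close>, where the rows are unit
  rows, and is annihilated by the rows of \<open>C\<close> in \<open>S\<close>. Either way each row
  contributes 0 to v^* C v.\<close>

lemma mask_nonsingular:
  assumes "positive_imaginary n C"
  shows "row_det n (row_mask S C) \<noteq> 0"
proof
  assume "row_det n (row_mask S C) = 0"
  then obtain v where v: "\<exists>a<n. v a \<noteq> 0" "\<And>a. a < n \<Longrightarrow> (\<Sum>b<n. row_mask S C a b * v b) = 0"
    by (rule row_det_0_kernel) blast
  have "(\<Sum>b<n. cnj (v a) * C a b * v b) = 0" if a: "a < n" for a
  proof (cases "a \<in> S")
    case True
    then have "(\<Sum>b<n. C a b * v b) = 0" using v(2)[OF a] by (simp add: row_mask_def)
    then show ?thesis by (simp add: mult.assoc flip: sum_distrib_left)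
  next
    case False
    then have "(\<Sum>b<n. of_bool (a = b) * v b) = 0" using v(2)[OF a] by (simp add: row_mask_def unit_row_def)
    then have "v a = 0" using a by simp
    then show ?thesis by simp
  qed
  then have "(\<Sum>a<n. \<Sum>b<n. cnj (v a) * C a b * v b) = 0" by (intro sum.neutral) blast
  moreover have "0 < Im (\<Sum>a<n. \<Sum>b<n. cnj (v a) * C a b * v b)"
    using assms v(1) unfolding positive_imaginary_def herm_form_def by blast
  ultimately show False by (simp only: zero_complex.sel)
qed

text \<open>The quotient is minus the sum of the roots with multiplicity; the induction splits off
  one root at a time.\<close>

lemma root_sum_Im_pos:
  fixes p :: "complex poly"
  assumes "degree p = Suc m" "\<And>z. poly p z = 0 \<Longrightarrow> Im z < 0"
  shows "Im (coeff p m / lead_coeff p) > 0"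
  using assms
proof (induction m arbitrary: p)
  case (Suc m)
  then obtain z where z: "poly p z = 0"
    using fundamental_theorem_of_algebra[of p] by (auto simp: constant_degree)
  then obtain q where q: "p = [:-z, 1:] * q" by (auto simp: poly_eq_0_iff_dvd)
  with Suc.prems have q0: "q \<noteq> 0" by auto
  then have "degree p = Suc (degree q)" unfolding q by (subst degree_mult_eq) auto
  then have dq: "degree q = Suc m" using Suc.prems by simp
  have "Im (coeff q m / lead_coeff q) > 0"
    using Suc.prems(2) by (intro Suc.IH dq) (simp add: q)
  moreover have "coeff p (Suc m) = coeff q m - z * lead_coeff q"
    unfolding q using dq by (simp add: coeff_eq_0)
  moreover have "lead_coeff p = lead_coeff q" unfolding q by (simp only: lead_coeff_mult) simp
  ultimately show ?case using Suc.prems(2)[OF z] q0 by (simp add: diff_divide_distrib)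
next
  case 0
  then obtain z where z: "poly p z = 0"
    using fundamental_theorem_of_algebra[of p] by (auto simp: constant_degree)
  then obtain q where q: "p = [:-z, 1:] * q" by (auto simp: poly_eq_0_iff_dvd)
  with 0 have q0: "q \<noteq> 0" by auto
  then have "degree p = Suc (degree q)" unfolding q by (subst degree_mult_eq) auto
  then have "degree q = 0" using 0 by simp
  then obtain d where d: "q = [:d:]" by (rule degree_eq_zeroE)
  show ?case using 0(2)[OF z] q0 by (simp add: q d)
qed

lemma coeff_subleading_nonzero:
  fixes p :: "complex poly"
  assumes "degree p \<le> Suc m" "coeff p (Suc m) \<noteq> 0" "\<And>z. Im z \<ge> 0 \<Longrightarrow> poly p z \<noteq> 0"
  shows "coeff p m \<noteq> 0"
proof -
  have "degree p = Suc m" using assms(1,2) le_degree by (metis le_antisym)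
  moreover have "Im z < 0" if "poly p z = 0" for z using assms(3) that by force
  ultimately have "Im (coeff p m / lead_coeff p) > 0" by (intro root_sum_Im_pos)
  then show ?thesis by auto
qed

text \<open>For the subleading coefficient one factor supplies its constant term and all others
  their slope. The shift by \<open>pCons 0\<close> avoids the index \<open>card K - 1\<close> and
  makes the formula valid for empty \<open>K\<close>, where both sides are 0.\<close>

lemma coeff_prod_linear:
  fixes f g :: "'b \<Rightarrow> 'a::comm_ring_1"
  assumes "finite K"
  shows "degree (\<Prod>i\<in>K. [:f i, g i:]) \<le> card K"
    and "coeff (\<Prod>i\<in>K. [:f i, g i:]) (card K) = (\<Prod>i\<in>K. g i)"
    and "coeff (pCons 0 (\<Prod>i\<in>K. [:f i, g i:])) (card K) = (\<Sum>y\<in>K. \<Prod>i\<in>K. if i = y then f i else g i)"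
proof -
  have "degree (\<Prod>i\<in>K. [:f i, g i:]) \<le> card K \<and>
    coeff (\<Prod>i\<in>K. [:f i, g i:]) (card K) = (\<Prod>i\<in>K. g i) \<and>
    coeff (pCons 0 (\<Prod>i\<in>K. [:f i, g i:])) (card K) = (\<Sum>y\<in>K. \<Prod>i\<in>K. if i = y then f i else g i)"
    using assms
  proof (induction K rule: finite_induct)
    case (insert k K)
    let ?P = "\<Prod>i\<in>K. [:f i, g i:]"
    have P: "(\<Prod>i\<in>insert k K. [:f i, g i:]) = smult (f k) ?P + pCons 0 (smult (g k) ?P)"
      using insert.hyps by simp
    have 1: "degree (\<Prod>i\<in>insert k K. [:f i, g i:]) \<le> card (insert k K)"
      unfolding P using insert
      by (intro degree_add_le) (auto intro!: order.trans[OF degree_smult_le] order.trans[OF degree_pCons_le])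
    have 2: "coeff (\<Prod>i\<in>insert k K. [:f i, g i:]) (card (insert k K)) = (\<Prod>i\<in>insert k K. g i)"
      unfolding P using insert by (simp add: coeff_eq_0)
    have 3: "(\<Prod>i\<in>insert k K. if i = y then f i else g i) = g k * (\<Prod>i\<in>K. if i = y then f i else g i)"
      if "y \<in> K" for y using insert.hyps that by (subst prod.insert) auto
    have 4: "(\<Prod>i\<in>insert k K. if i = k then f i else g i) = f k * (\<Prod>i\<in>K. g i)"
      using insert.hyps by (subst prod.insert) (auto intro!: arg_cong2[where f = "(*)"] prod.cong)
    have "coeff (pCons 0 (\<Prod>i\<in>insert k K. [:f i, g i:])) (card (insert k K)) = coeff (smult (f k) ?P + pCons 0 (smult (g k) ?P)) (card K)"
      unfolding P using insert.hyps by simp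
    also have "\<dots> = f k * (\<Prod>i\<in>K. g i) + g k * coeff (pCons 0 ?P) (card K)"
      using insert.IH by (cases "card K") auto
    also have "\<dots> = f k * (\<Prod>i\<in>K. g i) + (\<Sum>y\<in>K. g k * (\<Prod>i\<in>K. if i = y then f i else g i))"
      using insert.IH by (simp add: sum_distrib_left)
    also have "(\<Sum>y\<in>K. g k * (\<Prod>i\<in>K. if i = y then f i else g i)) = (\<Sum>y\<in>K. \<Prod>i\<in>insert k K. if i = y then f i else g i)"
      using 3 by (intro sum.cong) auto
    finally have "coeff (pCons 0 (\<Prod>i\<in>insert k K. [:f i, g i:])) (card (insert k K)) =
        (\<Sum>y\<in>insert k K. \<Prod>i\<in>insert k K. if i = y then f i else g i)"
      unfolding sum.insert[OF insert.hyps] 4 .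
    with 1 2 show ?case by blast
  qed simp
  then show "degree (\<Prod>i\<in>K. [:f i, g i:]) \<le> card K"
    "coeff (\<Prod>i\<in>K. [:f i, g i:]) (card K) = (\<Prod>i\<in>K. g i)"
    "coeff (pCons 0 (\<Prod>i\<in>K. [:f i, g i:])) (card K) = (\<Sum>y\<in>K. \<Prod>i\<in>K. if i = y then f i else g i)"
    by auto
qed

text \<open>The change adds z |v_t|^2 to the form, whose imaginary part is nonnegative.\<close>

lemma positive_imaginary_upd:
  assumes "positive_imaginary n C" "Im z \<ge> 0" "t < n"
  shows "positive_imaginary n (C(t := \<lambda>l. C t l + z * unit_row t l))"
  unfolding positive_imaginary_def herm_form_def
proof (intro allI impI)
  fix v :: "nat \<Rightarrow> complex" assume v: "\<exists>a<n. v a \<noteq> 0"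
  have "(\<Sum>b<n. cnj (v a) * (C(t := \<lambda>l. C t l + z * unit_row t l)) a b * v b)
     = (\<Sum>b<n. cnj (v a) * C a b * v b) + (if a = t then cnj (v t) * z * v t else 0)" for a
  proof (cases "a = t")
    case True
    have "(\<Sum>b<n. cnj (v t) * (C t b + z * of_bool (t = b)) * v b)
      = (\<Sum>b<n. cnj (v t) * C t b * v b) + (\<Sum>b<n. (cnj (v t) * z * v b) * of_bool (t = b))"
      by (simp only: sum.distrib[symmetric]) (simp add: algebra_simps)
    also have "(\<Sum>b<n. (cnj (v t) * z * v b) * of_bool (t = b)) = cnj (v t) * z * v t"
      using assms(3) by simp
    finally show ?thesis using True by (simp add: unit_row_def)
  qed simp
  then have "(\<Sum>a<n. \<Sum>b<n. cnj (v a) * (C(t := \<lambda>l. C t l + z * unit_row t l)) a b * v b)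
     = (\<Sum>a<n. \<Sum>b<n. cnj (v a) * C a b * v b) + cnj (v t) * z * v t"
    using assms(3) by (simp add: sum.distrib)
  moreover have "cnj (v t) * z * v t = of_real ((cmod (v t))\<^sup>2) * z"
    by (simp only: complex_norm_square) (simp add: mult_ac)
  then have "Im (cnj (v t) * z * v t) = (cmod (v t))\<^sup>2 * Im z"
    by (simp only: Im_complex_of_real Re_complex_of_real times_complex.sel)
  then have "Im (cnj (v t) * z * v t) \<ge> 0" using assms(2) by (metis mult_nonneg_nonneg zero_le_power2)
  moreover have "0 < Im (\<Sum>a<n. \<Sum>b<n. cnj (v a) * C a b * v b)"
    using assms(1) v unfolding positive_imaginary_def herm_form_def by blast
  ultimately show "0 < Im (\<Sum>a<n. \<Sum>b<n. cnj (v a) * (C(t := \<lambda>l. C t l + z * unit_row t l)) a b * v b)"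
    by simp
qed

text \<open>Only row \<open>t\<close> depends on \<open>z\<close>, and there the slope is the unit
  row at \<open>t\<close>, which is exactly how masking removes \<open>t\<close> from the
  minor.\<close>

lemma row_det_mask_insert:
  assumes "t < n" "t \<notin> S"
  shows "row_det n (row_mask (insert t S) (C(t := \<lambda>l. C t l + z * unit_row t l))) =
    row_det n (row_mask (insert t S) C) + z * row_det n (row_mask S C)"
proof -
  have 1: "row_mask (insert t S) (C(t := \<lambda>l. C t l + z * unit_row t l)) = (row_mask S C)(t := \<lambda>l. C t l + z * unit_row t l)"
    by (auto simp: row_mask_def)
  have 2: "row_mask (insert t S) C = (row_mask S C)(t := C t)" by (auto simp: row_mask_def)
  have 3: "(row_mask S C)(t := unit_row t) = row_mask S C" using assms by (auto simp: row_mask_def)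
  show ?thesis
    using row_det_add[OF assms(1), of "row_mask S C" "C t" z "unit_row t"] by (simp only: 1 2 3)
qed

lemma colour_sum_insert:
  assumes "finite K" "t \<notin> T" "t \<notin> U"
  shows "colour_sum n K (insert t T) U C = (\<Sum>c\<in>T \<rightarrow>\<^sub>E K. \<Sum>y\<in>K. \<Prod>i\<in>K.
     if i = y then row_det n (row_mask (insert t ({a \<in> T. c a = i} \<union> U)) (C i))
     else row_det n (row_mask ({a \<in> T. c a = i} \<union> U) (C i)))"
proof -
  have "colour_sum n K (insert t T) U C =
    (\<Sum>(y, c)\<in>K \<times> (T \<rightarrow>\<^sub>E K). \<Prod>i\<in>K. row_det n (row_mask ({a \<in> insert t T. (c(t := y)) a = i} \<union> U) (C i)))"
    unfolding colour_sum_def PiE_insert_eq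
    by (subst sum.reindex[OF inj_combinator[OF assms(2)]]) (simp only: o_def case_prod_unfold)
  also have "\<dots> = (\<Sum>(y, c)\<in>K \<times> (T \<rightarrow>\<^sub>E K). \<Prod>i\<in>K.
     if i = y then row_det n (row_mask (insert t ({a \<in> T. c a = i} \<union> U)) (C i))
     else row_det n (row_mask ({a \<in> T. c a = i} \<union> U) (C i)))"
  proof -
    have "{a \<in> insert t T. (c(t := y)) a = i} \<union> U =
      (if i = y then insert t ({a \<in> T. c a = i} \<union> U) else {a \<in> T. c a = i} \<union> U)" for c and y i :: nat
      using assms by auto
    then show ?thesis by (simp only: if_distrib[where f = "\<lambda>S. row_det n (row_mask S _)"])
  qed
  also have "\<dots> = (\<Sum>y\<in>K. \<Sum>c\<in>T \<rightarrow>\<^sub>E K. \<Prod>i\<in>K.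
     if i = y then row_det n (row_mask (insert t ({a \<in> T. c a = i} \<union> U)) (C i))
     else row_det n (row_mask ({a \<in> T. c a = i} \<union> U) (C i)))"
    by (rule sum.cartesian_product[symmetric])
  also have "\<dots> = (\<Sum>c\<in>T \<rightarrow>\<^sub>E K. \<Sum>y\<in>K. \<Prod>i\<in>K.
     if i = y then row_det n (row_mask (insert t ({a \<in> T. c a = i} \<union> U)) (C i))
     else row_det n (row_mask ({a \<in> T. c a = i} \<union> U) (C i)))"
    by (rule sum.swap)
  finally show ?thesis .
qed

text \<open>The indices of \<open>T\<close> are coloured one by one. The induction hypothesis is
  used twice, with \<open>U\<close> and with \<open>insert t U\<close> for a shifted
  \<open>C\<close>, hence both are arbitrary.\<close>

lemma colour_sum_nonzero:
  assumes "finite K" "K \<noteq> {}" "finite T" "T \<inter> U = {}" "T \<union> U \<subseteq> {..<n}"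
    and "\<And>i. i \<in> K \<Longrightarrow> positive_imaginary n (C i)"
  shows "colour_sum n K T U C \<noteq> 0"
  using assms(3-)
proof (induction T arbitrary: U C rule: finite_induct)
  case empty
  then show ?case using assms(1) by (simp add: colour_sum_def mask_nonsingular)
next
  case (insert t T)
  define f where "f c i = row_det n (row_mask (insert t ({a \<in> T. c a = i} \<union> U)) (C i))" for c i
  define g where "g c i = row_det n (row_mask ({a \<in> T. c a = i} \<union> U) (C i))" for c i
  \<comment> \<open>Adding \<open>z\<close> to the diagonal entry at \<open>t\<close> in every
    factor makes each factor linear in \<open>z\<close>. In the leading coefficient no factor
    contains \<open>t\<close>; in the subleading one exactly one does, and this factor is the colour
    of \<open>t\<close>.\<close>
  define P where "P = (\<Sum>c\<in>T \<rightarrow>\<^sub>E K. \<Prod>i\<in>K. [:f c i, g c i:])"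
  have fin: "finite (T \<rightarrow>\<^sub>E K)" using insert.hyps assms(1) by (intro finite_PiE)
  have t: "t < n" "t \<notin> U" "t \<notin> T" using insert by auto
  obtain m where m: "card K = Suc m" using assms(1,2) by (metis card_0_eq not0_implies_Suc)
  have dP: "degree P \<le> Suc m"
    unfolding P_def m[symmetric] using coeff_prod_linear(1)[OF assms(1)] fin by (intro degree_sum_le)
  have "coeff P (Suc m) = colour_sum n K T U C"
    unfolding P_def m[symmetric] colour_sum_def coeff_sum coeff_prod_linear(2)[OF assms(1)] g_def ..
  also have "\<dots> \<noteq> 0" using insert by (intro insert.IH) auto
  finally have c1: "coeff P (Suc m) \<noteq> 0" .
  have "coeff P m = (\<Sum>c\<in>T \<rightarrow>\<^sub>E K. coeff (pCons 0 (\<Prod>i\<in>K. [:f c i, g c i:])) (card K))"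
    unfolding P_def coeff_sum m by simp
  also have "\<dots> = colour_sum n K (insert t T) U C"
    unfolding coeff_prod_linear(3)[OF assms(1)] colour_sum_insert[OF assms(1) t(3,2)] f_def g_def ..
  finally have c2: "coeff P m = colour_sum n K (insert t T) U C" .
  have "poly P z \<noteq> 0" if z: "Im z \<ge> 0" for z
  proof -
    \<comment> \<open>At a point \<open>z\<close> the index \<open>t\<close> lies in all factors, so
      the value is again such a sum, with \<open>t\<close> moved to \<open>U\<close>.\<close>
    have "poly P z = colour_sum n K T (insert t U) (\<lambda>i. (C i)(t := \<lambda>l. C i t l + z * unit_row t l))"
      unfolding P_def colour_sum_def poly_sum poly_prod
    proof (intro sum.cong prod.cong refl)
      fix c i
      have "row_det n (row_mask ({a \<in> T. c a = i} \<union> insert t U) ((C i)(t := \<lambda>l. C i t l + z * unit_row t l))) = f c i + z * g c i"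
        unfolding f_def g_def Un_insert_right by (rule row_det_mask_insert) (use t in auto)
      then show "poly [:f c i, g c i:] z = row_det n (row_mask ({a \<in> T. c a = i} \<union> insert t U) ((C i)(t := \<lambda>l. C i t l + z * unit_row t l)))"
        by simp
    qed
    also have "\<dots> \<noteq> 0" using insert.prems insert.hyps z
      by (intro insert.IH positive_imaginary_upd) auto
    finally show ?thesis .
  qed
  then show ?case using coeff_subleading_nonzero[OF dP c1] c2 by simp
qed

section \<open>Partial fractions of Herglotz functions\<close>

text \<open>If d >= 2, the powers z^d of points of the upper half-plane take every argument in (0, 2
  pi), so some value of c / z^d lies in the upper half-plane. For d = 1 the sign conditions at
  \<open>\<i>\<close> and near 1 and -1 determine \<open>c\<close>.\<close>

lemma herglotz_power:
  assumes "c \<noteq> 0" "d \<noteq> 0" "\<And>z. Im z > 0 \<Longrightarrow> Im (c / z ^ d) \<le> 0"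
  shows "d = 1" "Im c = 0" "Re c \<ge> 0"
proof -
  show d1: "d = 1"
  proof (rule ccontr)
    assume "d \<noteq> 1"
    then have d2: "2 \<le> real d" using assms(2) by simp
    \<comment> \<open>The argument of \<open>c\<close> is normalized to (0, 2 pi] so that \<theta> -
      \<delta> is positive for a small \<delta>; then z = cis ((\<theta> - \<delta>) / d) has
      argument below pi, and c / z^d has argument \<delta>.\<close>
    obtain \<theta> where \<theta>: "0 < \<theta>" "\<theta> \<le> 2 * pi" "c = rcis (cmod c) \<theta>"
    proof (cases "Arg c > 0")
      case True
      then show ?thesis using that[of "Arg c"] Arg_bounded[of c] by (simp add: rcis_cmod_Arg)
    next
      case False
      have "rcis (cmod c) (Arg c + 2 * pi) = rcis (cmod c) (Arg c)"
        by (simp add: rcis_def cis.ctr)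
      then show ?thesis using that[of "Arg c + 2 * pi"] Arg_bounded[of c] False
        by (simp add: rcis_cmod_Arg)
    qed
    define \<delta> where "\<delta> = min (\<theta> / 2) (pi / 2)"
    have \<delta>: "0 < \<delta>" "\<delta> < \<theta>" "\<delta> < pi" using \<theta> by (auto simp: \<delta>_def min_def)
    define z where "z = cis ((\<theta> - \<delta>) / d)"
    have "0 < (\<theta> - \<delta>) / d" using \<delta> d2 by simp
    moreover have "(\<theta> - \<delta>) / d < pi"
    proof -
      have "\<theta> - \<delta> < pi * 2" using \<theta> \<delta> by simp
      also have "\<dots> \<le> pi * d" using d2 by simp
      finally show ?thesis using d2 by (simp add: field_simps)
    qed
    ultimately have "Im z > 0" by (simp add: z_def sin_gt_zero)
    moreover have "z ^ d = cis (\<theta> - \<delta>)" using assms(2) by (simp add: z_def DeMoivre)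
    then have "c / z ^ d = rcis (cmod c) \<delta>" by (subst \<theta>(3)) (simp add: rcis_def cis_divide flip: times_divide_eq_right)
    then have "Im (c / z ^ d) > 0" using \<delta> assms(1) by (simp add: sin_gt_zero)
    ultimately show False using assms(3)[of z] by simp
  qed
  have "Im (c / \<i>) \<le> 0" using assms(3)[of \<i>] by (simp add: d1)
  then show re: "Re c \<ge> 0" by (simp add: Im_divide)
  \<comment> \<open>Test points s + i e with s = 1 or s = -1; letting e tend to 0 bounds
    \<open>Im c\<close> from both sides.\<close>
  have *: "Im c * s \<le> Re c * e" if "e > 0" "s\<^sup>2 = 1" for e s
  proof -
    have "Im (c / Complex s e) \<le> 0" using assms(3)[of "Complex s e"] that by (simp add: d1)
    moreover have "s\<^sup>2 + e\<^sup>2 > 0" using that by (simp add: add_pos_pos)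
    ultimately show ?thesis by (simp add: Im_divide divide_le_0_iff)
  qed
  have "Im c * s \<le> 0" if "s\<^sup>2 = 1" for s
  proof (rule field_le_epsilon)
    fix e :: real assume e: "e > 0"
    have "Im c * s \<le> Re c * (e / (Re c + 1))" using that re e by (intro *) auto
    also have "\<dots> \<le> e" using re e by (simp add: field_simps)
    finally show "Im c * s \<le> 0 + e" by simp
  qed
  from this[of 1] this[of "-1"] show "Im c = 0" by simp
qed

text \<open>This is the residue of p / q at a root \<open>l\<close> of \<open>q\<close> provided
  that the pole is at most simple, that is, the first \<open>div\<close> is exact. The formula then
  allows a common zero of \<open>p\<close> and \<open>q\<close>.\<close>

definition simple_residue :: "complex poly \<Rightarrow> complex poly \<Rightarrow> complex \<Rightarrow> complex" where
  "simple_residue p q l = poly (p div [:- l, 1:] ^ (order l q - 1)) l / poly (q div [:- l, 1:] ^ order l q) l"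

lemma order_cofactor:
  fixes q :: "complex poly"
  assumes "q \<noteq> 0"
  shows "q = [:- l, 1:] ^ order l q * (q div [:- l, 1:] ^ order l q)"
    and "poly (q div [:- l, 1:] ^ order l q) l \<noteq> 0"
proof -
  show 1: "q = [:- l, 1:] ^ order l q * (q div [:- l, 1:] ^ order l q)"
    using order_1[of l q] by simp
  show "poly (q div [:- l, 1:] ^ order l q) l \<noteq> 0"
  proof
    assume "poly (q div [:- l, 1:] ^ order l q) l = 0"
    then obtain s where "q div [:- l, 1:] ^ order l q = [:- l, 1:] * s"
      by (auto simp: poly_eq_0_iff_dvd)
    with 1 have "q = [:- l, 1:] ^ Suc (order l q) * s" by (metis mult.assoc power_Suc2)
    then have "[:- l, 1:] ^ Suc (order l q) dvd q" by (metis dvd_triv_left)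
    then show False using order_2[OF assms] by blast
  qed
qed

text \<open>Near \<open>l\<close> the quotient behaves like c / (x - l)^d. Since \<open>l\<close> is
  real, the leading term inherits the sign condition on the whole upper half-plane, and
  \<open>herglotz_power\<close> applies to it.\<close>

lemma herglotz_simple_pole:
  fixes p q :: "complex poly"
  assumes q: "q \<noteq> 0" "poly q l = 0" and l: "Im l = 0"
    and im: "\<And>x. Im x > 0 \<Longrightarrow> Im (poly p x / poly q x) \<le> 0"
  shows "[:- l, 1:] ^ (order l q - 1) dvd p"
    and "Im (simple_residue p q l) = 0" and "Re (simple_residue p q l) \<ge> 0"
proof -
  define m where "m = order l q"
  define r where "r = q div [:- l, 1:] ^ m"
  have qr: "q = [:- l, 1:] ^ m * r" "poly r l \<noteq> 0"
    using order_cofactor[OF q(1)] unfolding m_def r_def by auto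
  have m0: "m \<noteq> 0" using q by (simp add: m_def order_root)
  have "[:- l, 1:] ^ (order l q - 1) dvd p \<and> Im (simple_residue p q l) = 0 \<and> Re (simple_residue p q l) \<ge> 0"
  proof (cases "p = 0 \<or> order l p \<ge> m")
    case True
    \<comment> \<open>No pole at all: the residue formula then evaluates to 0.\<close>
    then have "[:- l, 1:] ^ m dvd p" by (auto simp: order_divides)
    then obtain t where t: "p = [:- l, 1:] ^ m * t" by (auto elim: dvdE)
    have "p = [:- l, 1:] ^ (m - 1) * ([:- l, 1:] * t)"
      unfolding t using m0 by (metis mult.assoc power_minus_mult neq0_conv)
    then have "[:- l, 1:] ^ (m - 1) dvd p" "p div [:- l, 1:] ^ (m - 1) = [:- l, 1:] * t"
      by (metis dvd_triv_left, metis nonzero_mult_div_cancel_left power_not_zero pCons_eq_0_iff zero_neq_one)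
    then show ?thesis by (simp add: simple_residue_def m_def)
  next
    case False
    define s where "s = order l p"
    define t where "t = p div [:- l, 1:] ^ s"
    have pt: "p = [:- l, 1:] ^ s * t" "poly t l \<noteq> 0"
      using order_cofactor[of p] False unfolding s_def t_def by auto
    define d where "d = m - s"
    have d: "m = s + d" "d \<noteq> 0" using False by (auto simp: d_def s_def)
    \<comment> \<open>Approach \<open>l\<close> along the ray l + e z. Multiplying by the positive
      real e^d keeps the sign and isolates the leading term as e tends to 0.\<close>
    have "Im (poly t l / poly r l / z ^ d) \<le> 0" if z: "Im z > 0" for z
    proof (rule tendsto_upperbound)
      let ?f = "\<lambda>e::real. Im (poly t (l + of_real e * z) / poly r (l + of_real e * z) / z ^ d)"
      have "((\<lambda>e::real. l + of_real e * z) \<longlongrightarrow> l) (at_right 0)" by (auto intro!: tendsto_eq_intros)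
      then have "((\<lambda>e::real. poly u (l + of_real e * z)) \<longlongrightarrow> poly u l) (at_right 0)" for u
        by (rule isCont_tendsto_compose[OF poly_isCont])
      then show "(?f \<longlongrightarrow> Im (poly t l / poly r l / z ^ d)) (at_right 0)"
        using qr(2) z by (intro tendsto_Im tendsto_divide tendsto_const) auto
      have "?f e \<le> 0" if e: "e > 0" for e
      proof -
        let ?y = "of_real e * z"
        have y0: "?y \<noteq> 0" using e z by auto
        have "Im (l + ?y) > 0" using e z l by simp
        then have "Im (poly p (l + ?y) / poly q (l + ?y)) \<le> 0" by (rule im)
        moreover have "poly p (l + ?y) / poly q (l + ?y) = (?y ^ s * poly t (l + ?y)) / (?y ^ s * (?y ^ d * poly r (l + ?y)))"
          by (simp add: pt(1) qr(1) d(1) power_add mult.assoc)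
        also have "\<dots> = poly t (l + ?y) / (?y ^ d * poly r (l + ?y))"
          using y0 by simp
        also have "\<dots> = (poly t (l + ?y) / poly r (l + ?y) / z ^ d) / of_real (e ^ d)"
          by (simp add: power_mult_distrib field_simps)
        finally have "Im ((poly t (l + ?y) / poly r (l + ?y) / z ^ d) / of_real (e ^ d)) \<le> 0"
          using \<open>Im (poly p (l + ?y) / poly q (l + ?y)) \<le> 0\<close> by metis
        then have "?f e / e ^ d \<le> 0" by (simp only: Im_divide_of_real)
        then show ?thesis using e by (metis divide_le_0_iff zero_less_power not_less)
      qed
      then show "\<forall>\<^sub>F e in at_right 0. ?f e \<le> 0"
        by (auto simp: eventually_at_right_field intro: exI[of _ 1])
    qed auto
    then have c: "d = 1" "Im (poly t l / poly r l) = 0" "Re (poly t l / poly r l) \<ge> 0"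
      using herglotz_power[of "poly t l / poly r l" d] qr(2) pt(2) d(2) by auto
    then have s: "s = order l q - 1" using d m_def by simp
    have "simple_residue p q l = poly t l / poly r l"
      by (simp add: simple_residue_def t_def r_def s m_def)
    moreover have "[:- l, 1:] ^ (order l q - 1) dvd p" using pt(1) s by (metis dvd_triv_left)
    ultimately show ?thesis using c by simp
  qed
  then show "[:- l, 1:] ^ (order l q - 1) dvd p"
    "Im (simple_residue p q l) = 0" "Re (simple_residue p q l) \<ge> 0" by auto
qed

text \<open>Over the complex numbers \<open>q\<close> is a constant times the product of its root
  factors with multiplicity, so divisibility can be tested root by root.\<close>

lemma dvd_of_order_dvd:
  fixes p q :: "complex poly"
  assumes "q \<noteq> 0" "\<And>l. poly q l = 0 \<Longrightarrow> [:- l, 1:] ^ order l q dvd p"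
  shows "q dvd p"
proof (cases "p = 0")
  case False
  have "poly p l = 0" if "poly q l = 0" for l
  proof -
    have "[:- l, 1:] dvd [:- l, 1:] ^ order l q" using that assms(1) by (simp add: order_root dvd_power)
    then have "[:- l, 1:] dvd p" using assms(2)[OF that] by (rule dvd_trans)
    then show ?thesis by (simp add: poly_eq_0_iff_dvd)
  qed
  then have "(\<Prod>l | poly q l = 0. [:- l, 1:] ^ order l q) dvd (\<Prod>l | poly p l = 0. [:- l, 1:] ^ order l p)"
    using False assms(2) by (intro prod_dvd_prod_subset2 poly_roots_finite) (auto simp: order_divides le_imp_power_dvd)
  then have "smult (lead_coeff q) (\<Prod>l | poly q l = 0. [:- l, 1:] ^ order l q)
      dvd smult (lead_coeff p) (\<Prod>l | poly p l = 0. [:- l, 1:] ^ order l p)"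
    using assms(1) by (intro dvd_smult) (simp add: smult_dvd_iff)
  then show ?thesis by (simp only: complex_poly_decompose)
qed simp

text \<open>The candidate numerator, the sum of residues times q / (x - l), differs from
  \<open>p\<close> by a polynomial of degree below that of \<open>q\<close> which is divisible by
  the full root factor of \<open>q\<close> at every root. Hence the difference is 0; multiple roots
  of \<open>q\<close> need no special treatment.\<close>

lemma partial_fractions_simple:
  fixes p q :: "complex poly"
  assumes q: "q \<noteq> 0" and deg: "degree p < degree q"
    and dvd: "\<And>l. poly q l = 0 \<Longrightarrow> [:- l, 1:] ^ (order l q - 1) dvd p"
    and x: "poly q x \<noteq> 0"
  shows "poly p x / poly q x = (\<Sum>l | poly q l = 0. simple_residue p q l / (x - l))"
proof -
  define h where "h l = q div [:- l, 1:]" for l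
  have h: "q = [:- l, 1:] * h l" if "poly q l = 0" for l
    using that unfolding h_def by (simp only: poly_eq_0_iff_dvd dvd_mult_div_cancel)
  have fin: "finite {l. poly q l = 0}" using q by (rule poly_roots_finite)
  define e where "e = p - (\<Sum>l | poly q l = 0. smult (simple_residue p q l) (h l))"
  have "degree (h l) < degree q" if "poly q l = 0" for l
  proof -
    have "degree q = degree [:- l, 1:] + degree (h l)"
      using h[OF that] q by (metis degree_mult_eq mult_eq_0_iff)
    then show ?thesis by simp
  qed
  then have "degree (\<Sum>l | poly q l = 0. smult (simple_residue p q l) (h l)) < degree q"
    using deg by (intro degree_sum_less) (auto intro: le_less_trans[OF degree_smult_le])
  then have de: "degree e < degree q" unfolding e_def using deg by (rule degree_diff_less[rotated])
  have "[:- m, 1:] ^ order m q dvd e" if m: "poly q m = 0" for m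
  proof -
    let ?P = "[:- m, 1:]"
    define r where "r = q div ?P ^ order m q"
    have qr: "q = ?P ^ order m q * r" "poly r m \<noteq> 0"
      using order_cofactor[OF q] unfolding r_def by auto
    have o: "order m q = Suc (order m q - 1)" using m q by (simp add: order_root)
    obtain s where s: "p = ?P ^ (order m q - 1) * s" using dvd[OF m] by (auto elim: dvdE)
    have res: "simple_residue p q m = poly s m / poly r m"
      unfolding simple_residue_def r_def by (subst s) simp
    have "?P * h m = ?P * (?P ^ (order m q - 1) * r)"
      using h[OF m] qr(1) o by (metis mult.assoc power_Suc)
    then have hm: "h m = ?P ^ (order m q - 1) * r" by (metis mult_left_cancel pCons_eq_0_iff zero_neq_one)
    have "poly (s - smult (simple_residue p q m) r) m = 0" using qr(2) res by simp
    then have "?P dvd s - smult (simple_residue p q m) r" by (simp only: poly_eq_0_iff_dvd)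
    then obtain u where u: "s - smult (simple_residue p q m) r = ?P * u" by (rule dvdE)
    have "p - smult (simple_residue p q m) (h m) = ?P ^ (order m q - 1) * (s - smult (simple_residue p q m) r)"
      unfolding hm by (subst s) (simp add: algebra_simps)
    also have "\<dots> = ?P ^ order m q * u" unfolding u using o by (metis mult.assoc power_Suc2)
    finally have 1: "?P ^ order m q dvd p - smult (simple_residue p q m) (h m)" by simp
    \<comment> \<open>Dividing \<open>q\<close> by the factor of another root leaves the
      multiplicity at \<open>m\<close> untouched, so only the summand for \<open>m\<close> has to be
      cancelled.\<close>
    have 2: "?P ^ order m q dvd h l" if "poly q l = 0" "l \<noteq> m" for l
    proof -
      have "order m q = order m [:- l, 1:] + order m (h l)"
        using h[OF that(1)] q by (metis order_mult)
      also have "order m [:- l, 1:] = 0" using that(2) by (intro order_0I) auto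
      finally show ?thesis by (simp add: order_divides)
    qed
    have "e = (p - smult (simple_residue p q m) (h m)) - (\<Sum>l\<in>{l. poly q l = 0} - {m}. smult (simple_residue p q l) (h l))"
      unfolding e_def using fin m by (subst sum.remove[of _ m]) auto
    also have "?P ^ order m q dvd \<dots>" using 2 by (intro dvd_diff[OF 1] dvd_sum dvd_smult) auto
    finally show ?thesis .
  qed
  then have "q dvd e" by (rule dvd_of_order_dvd[OF q])
  then have "e = 0" using de by (metis dvd_imp_degree_le not_less)
  then have "poly e x = 0" by simp
  then have "poly p x - (\<Sum>l | poly q l = 0. simple_residue p q l * poly (h l) x) = 0"
    by (simp add: e_def poly_sum)
  then have "poly p x = (\<Sum>l | poly q l = 0. simple_residue p q l * poly (h l) x)" by simp
  also have "\<dots> = (\<Sum>l | poly q l = 0. poly q x * (simple_residue p q l / (x - l)))"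
  proof (intro sum.cong refl)
    fix l assume "l \<in> {l. poly q l = 0}"
    then have q0: "poly q l = 0" by simp
    have "poly q x = poly ([:- l, 1:] * h l) x" using h[OF q0] by (rule arg_cong)
    then have "poly q x = (x - l) * poly (h l) x" by (simp add: algebra_simps)
    moreover have "x \<noteq> l" using q0 x by auto
    ultimately show "simple_residue p q l * poly (h l) x = poly q x * (simple_residue p q l / (x - l))"
      by simp
  qed
  finally show ?thesis using x unfolding sum_distrib_left[symmetric] by (metis nonzero_mult_div_cancel_left)
qed

section \<open>Passing between Hermitian forms and matrix entries\<close>

definition poly_form :: "nat \<Rightarrow> (nat \<Rightarrow> nat \<Rightarrow> complex poly) \<Rightarrow> (nat \<Rightarrow> complex) \<Rightarrow> complex poly" where
  "poly_form n N v = (\<Sum>a<n. \<Sum>b<n. smult (cnj (v a) * v b) (N a b))"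

lemma poly_poly_form: "poly (poly_form n N v) x = herm_form n (\<lambda>a b. poly (N a b) x) v"
  unfolding poly_form_def herm_form_def by (simp add: poly_sum mult_ac)

lemma double_sum_two_point:
  fixes g :: "nat \<Rightarrow> nat \<Rightarrow> 'a::comm_monoid_add"
  assumes "a < n" "b < n" "a \<noteq> b" "\<And>x y. x \<notin> {a, b} \<or> y \<notin> {a, b} \<Longrightarrow> g x y = 0"
  shows "(\<Sum>x<n. \<Sum>y<n. g x y) = g a a + g a b + g b a + g b b"
proof -
  have "(\<Sum>y<n. g x y) = g x a + g x b" for x
  proof -
    have "(\<Sum>y<n. g x y) = (\<Sum>y\<in>{a, b}. g x y)"
      using assms by (intro sum.mono_neutral_right) auto
    then show ?thesis using assms(3) by simp
  qed
  then have "(\<Sum>x<n. \<Sum>y<n. g x y) = (\<Sum>x<n. g x a + g x b)" by simp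
  also have "\<dots> = (\<Sum>x\<in>{a, b}. g x a + g x b)"
    using assms by (intro sum.mono_neutral_right) auto
  finally show ?thesis using assms(3) by (simp add: add_ac)
qed

lemma double_sum_one_point:
  fixes g :: "nat \<Rightarrow> nat \<Rightarrow> 'a::comm_monoid_add"
  assumes "a < n" "\<And>x y. x \<noteq> a \<or> y \<noteq> a \<Longrightarrow> g x y = 0"
  shows "(\<Sum>x<n. \<Sum>y<n. g x y) = g a a"
proof -
  have "(\<Sum>x<n. \<Sum>y<n. g x y) = (\<Sum>x\<in>{a}. \<Sum>y<n. g x y)"
    using assms by (intro sum.mono_neutral_right) auto
  also have "\<dots> = (\<Sum>y<n. g a y)" by simp
  also have "(\<Sum>y<n. g a y) = (\<Sum>y\<in>{a}. g a y)"
    using assms by (intro sum.mono_neutral_right) auto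
  finally show ?thesis by simp
qed

lemma poly_form_unit: "a < n \<Longrightarrow> poly_form n N (\<lambda>x. of_bool (x = a)) = N a a"
  unfolding poly_form_def by (subst double_sum_one_point[of a]) auto

text \<open>The test vectors are e_a + e_b and e_a + i e_b; in this combination the contribution of
  \<open>N b a\<close> cancels. It transfers divisibility from the forms to a single off-diagonal
  entry.\<close>

lemma poly_form_polarization:
  assumes "a < n" "b < n" "a \<noteq> b"
  shows "smult 2 (N a b) = poly_form n N (\<lambda>x. if x = a then 1 else of_bool (x = b))
    - smult \<i> (poly_form n N (\<lambda>x. if x = a then 1 else \<i> * of_bool (x = b)))
    - smult (1 - \<i>) (N a a + N b b)"
proof -
  have 1: "poly_form n N (\<lambda>x. if x = a then 1 else of_bool (x = b)) = N a a + N a b + N b a + N b b"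
    unfolding poly_form_def by (subst double_sum_two_point[of a _ b]) (use assms in auto)
  have 2: "poly_form n N (\<lambda>x. if x = a then 1 else \<i> * of_bool (x = b))
      = N a a + smult \<i> (N a b) + smult (- \<i>) (N b a) + N b b"
    unfolding poly_form_def by (subst double_sum_two_point[of a _ b]) (use assms in auto)
  show ?thesis unfolding 1 2 by (rule poly_eqI) (simp add: algebra_simps)
qed

text \<open>The form at e_a makes the diagonal real; at e_a + e_b it matches the imaginary parts of
  the two off-diagonal entries, at e_a + i e_b their real parts.\<close>

lemma hermitian_of_real_form:
  assumes "\<And>v. Im (herm_form n M v) = 0" "a < n" "b < n"
  shows "M b a = cnj (M a b)"
proof -
  have d: "Im (M x x) = 0" if "x < n" for x
    using assms(1)[of "\<lambda>y. of_bool (y = x)"] that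
    unfolding herm_form_def by (subst (asm) double_sum_one_point[of x]) auto
  show ?thesis
  proof (cases "a = b")
    case True
    then show ?thesis using d assms(2) by (simp add: complex_eq_iff)
  next
    case False
    have "Im (M a b + M b a) = 0"
      using assms(1)[of "\<lambda>x. if x = a then 1 else of_bool (x = b)"] assms(2,3) False d
      unfolding herm_form_def by (subst (asm) double_sum_two_point[of a _ b]) auto
    moreover have "Re (M a b) = Re (M b a)"
      using assms(1)[of "\<lambda>x. if x = a then 1 else \<i> * of_bool (x = b)"] assms(2,3) False d
      unfolding herm_form_def by (subst (asm) double_sum_two_point[of a _ b]) auto
    ultimately show ?thesis by (simp add: complex_eq_iff)
  qed
qed

text \<open>For a fixed \<open>v\<close> the scalar result gives a simple pole with nonnegative
  residue. Taking residues commutes with forming v^* N v, so the residue matrices are positive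
  semidefinite.\<close>

lemma herglotz_matrix_residues:
  fixes q :: "complex poly" and N :: "nat \<Rightarrow> nat \<Rightarrow> complex poly"
  assumes q: "q \<noteq> 0" and deg: "\<And>a b. a < n \<Longrightarrow> b < n \<Longrightarrow> degree (N a b) < degree q"
    and real: "\<And>l. poly q l = 0 \<Longrightarrow> Im l = 0"
    and im: "\<And>v x. Im x > 0 \<Longrightarrow> Im (herm_form n (\<lambda>a b. poly (N a b) x) v / poly q x) \<le> 0"
  shows "\<And>a b x. a < n \<Longrightarrow> b < n \<Longrightarrow> poly q x \<noteq> 0 \<Longrightarrow>
      poly (N a b) x / poly q x = (\<Sum>l | poly q l = 0. simple_residue (N a b) q l / (x - l))"
    and "\<And>l v. poly q l = 0 \<Longrightarrow> Im (herm_form n (\<lambda>a b. simple_residue (N a b) q l) v) = 0"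
    and "\<And>l v. poly q l = 0 \<Longrightarrow> Re (herm_form n (\<lambda>a b. simple_residue (N a b) q l) v) \<ge> 0"
proof -
  have im': "Im (poly (poly_form n N v) x / poly q x) \<le> 0" if "Im x > 0" for v x
    unfolding poly_poly_form using that by (rule im)
  note pole = herglotz_simple_pole[OF q _ real im', rotated]
  have form: "[:- l, 1:] ^ (order l q - 1) dvd poly_form n N v" if "poly q l = 0" for l v
    using that by (intro pole) auto
  have dvd: "[:- l, 1:] ^ (order l q - 1) dvd N a b" if l: "poly q l = 0" and ab: "a < n" "b < n" for l a b
  proof -
    have diag: "[:- l, 1:] ^ (order l q - 1) dvd N c c" if "c < n" for c
      using form[OF l] poly_form_unit[OF that, of N] by metis
    show ?thesis
    proof (cases "a = b")
      case False
      have "[:- l, 1:] ^ (order l q - 1) dvd smult 2 (N a b)"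
        unfolding poly_form_polarization[OF ab False]
        using form[OF l] diag ab by (intro dvd_diff dvd_smult dvd_add) auto
      then show ?thesis by (simp add: dvd_smult_iff)
    qed (use diag ab in auto)
  qed
  show "poly (N a b) x / poly q x = (\<Sum>l | poly q l = 0. simple_residue (N a b) q l / (x - l))"
    if "a < n" "b < n" "poly q x \<noteq> 0" for a b x
    using that q deg dvd by (intro partial_fractions_simple) auto
  have res: "simple_residue (poly_form n N v) q l = herm_form n (\<lambda>a b. simple_residue (N a b) q l) v"
    if l: "poly q l = 0" for l v
  proof -
    define P where "P = [:- l, 1:] ^ (order l q - 1)"
    have P0: "P \<noteq> 0" by (simp add: P_def)
    \<comment> \<open>All entries are divisible by \<open>P\<close>, so \<open>div\<close> is exact
      and commutes with the form.\<close>
    have "poly_form n N v = P * poly_form n (\<lambda>a b. N a b div P) v"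
      unfolding poly_form_def sum_distrib_left
      using dvd[OF l] by (intro sum.cong refl) (simp add: P_def)
    then have "poly_form n N v div P = poly_form n (\<lambda>a b. N a b div P) v"
      using P0 by simp
    then show ?thesis
      unfolding simple_residue_def P_def[symmetric] by (simp add: poly_poly_form herm_form_def sum_divide_distrib)
  qed
  show "Im (herm_form n (\<lambda>a b. simple_residue (N a b) q l) v) = 0"
    "Re (herm_form n (\<lambda>a b. simple_residue (N a b) q l) v) \<ge> 0" if l: "poly q l = 0" for l v
    using pole(2,3)[of l v] l unfolding res[OF l] by auto
qed

section \<open>Mixed sums and rank-one perturbations\<close>

text \<open>An element of \<open>S\<close> is picked at the position given by the number of smaller
  elements of \<open>S\<close>; injectivity then follows by counting.\<close>

lemma bij_betw_pick:
  assumes "finite S"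
  shows "bij_betw (pick S) {..<card S} S"
proof -
  have "S \<subseteq> pick S ` {..<card S}"
  proof
    fix i assume i: "i \<in> S"
    then have "{a \<in> S. a < i} \<subset> S" by auto
    then have "card {a \<in> S. a < i} < card S" using assms by (intro psubset_card_mono)
    then show "i \<in> pick S ` {..<card S}"
      using pick_card_in_set[OF i] by (intro image_eqI[of _ _ "card {a \<in> S. a < i}"]) simp_all
  qed
  moreover have "card (pick S ` {..<card S}) \<le> card S"
    using card_image_le[of "{..<card S}" "pick S"] by simp
  ultimately have "pick S ` {..<card S} = S" by (metis card_seteq finite_imageI finite_lessThan)
  moreover from this have "inj_on (pick S) {..<card S}"
    by (intro eq_card_imp_inj_on) auto
  ultimately show ?thesis by (simp add: bij_betw_def)
qed

text \<open>A permutation that moves an index outside \<open>S\<close> meets an off-diagonal zero of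
  a unit row, so only permutations of \<open>S\<close> survive, as in the Leibniz formula of the
  principal minor.\<close>

lemma row_det_row_mask:
  assumes "S \<subseteq> {..<n}"
  shows "row_det n (row_mask S f) = (\<Sum>p | p permutes S. of_int (sign p) * (\<Prod>a\<in>S. f a (p a)))"
proof -
  have fin: "finite {p. p permutes {..<n}}" by (simp add: finite_permutations)
  have "(\<Sum>p | p permutes {..<n}. of_int (sign p) * (\<Prod>a<n. row_mask S f a (p a)))
      = (\<Sum>p | p permutes S. of_int (sign p) * (\<Prod>a<n. row_mask S f a (p a)))"
  proof (rule sum.mono_neutral_right[OF fin])
    show "{p. p permutes S} \<subseteq> {p. p permutes {..<n}}" using assms by (auto intro: permutes_subset)
    show "\<forall>p\<in>{p. p permutes {..<n}} - {p. p permutes S}. of_int (sign p) * (\<Prod>a<n. row_mask S f a (p a)) = 0"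
    proof
      fix p assume p: "p \<in> {p. p permutes {..<n}} - {p. p permutes S}"
      then obtain a where a: "a < n" "a \<notin> S" "p a \<noteq> a"
        using permutes_superset[of p "{..<n}" S] by auto
      then have "row_mask S f a (p a) = 0" by (auto simp: row_mask_def unit_row_def)
      then have "(\<Prod>a<n. row_mask S f a (p a)) = 0" using a(1) by (intro prod_zero) auto
      then show "of_int (sign p) * (\<Prod>a<n. row_mask S f a (p a)) = 0" by simp
    qed
  qed
  also have "\<dots> = (\<Sum>p | p permutes S. of_int (sign p) * (\<Prod>a\<in>S. f a (p a)))"
  proof (intro sum.cong refl)
    fix p assume "p \<in> {p. p permutes S}"
    then have "(\<Prod>a<n. row_mask S f a (p a)) = (\<Prod>a\<in>S. row_mask S f a (p a))"
      using assms by (intro prod.mono_neutral_right) (auto simp: row_mask_def unit_row_def permutes_not_in)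
    also have "\<dots> = (\<Prod>a\<in>S. f a (p a))" by (simp add: row_mask_def)
    finally show "of_int (sign p) * (\<Prod>a<n. row_mask S f a (p a)) = of_int (sign p) * (\<Prod>a\<in>S. f a (p a))" by simp
  qed
  finally show ?thesis unfolding row_det_leibniz .
qed

text \<open>Conjugation with the increasing enumeration of \<open>S\<close> matches permutations of
  positions with permutations of \<open>S\<close> and preserves signs.\<close>

lemma row_det_pick:
  assumes "S \<subseteq> {..<n}"
  shows "row_det (card S) (\<lambda>i l. f (pick S i) (pick S l)) = row_det n (row_mask S f)"
proof -
  have fin: "finite S" using assms finite_subset by blast
  let ?I = "{..<card S}"
  have bij: "bij_betw (pick S) ?I S" using fin by (rule bij_betw_pick)
  define g where "g = inv_into ?I (pick S)"
  have bij': "bij_betw g S ?I" unfolding g_def using bij by (rule bij_betw_inv_into)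
  have gf: "g (pick S i) = i" if "i \<in> ?I" for i
    unfolding g_def using bij that by (metis bij_betw_inv_into_left)
  have fg: "pick S (g a) = a" if "a \<in> S" for a
    unfolding g_def using bij that by (metis bij_betw_inv_into_right)
  have inj: "inj_on (pick S) ?I" using bij by (rule bij_betw_imp_inj_on)
  have "(\<Sum>p | p permutes ?I. of_int (sign p) * (\<Prod>i<card S. f (pick S i) (pick S (p i))))
     = (\<Sum>p | p permutes S. of_int (sign p) * (\<Prod>a\<in>S. f a (p a)))"
  proof (rule sum.reindex_bij_witness[of _ "map_permutation S g" "map_permutation ?I (pick S)"])
    fix p assume "p \<in> {p. p permutes S}"
    then show "map_permutation ?I (pick S) (map_permutation S g p) = p" "map_permutation S g p \<in> {p. p permutes ?I}"
      using map_permutation_compose_inv[OF bij', of p] map_permutation_permutes[OF bij'] fg by auto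
  next
    fix p assume "p \<in> {p. p permutes ?I}"
    then have p: "p permutes ?I" by simp
    show "map_permutation S g (map_permutation ?I (pick S) p) = p" "map_permutation ?I (pick S) p \<in> {p. p permutes S}"
      using map_permutation_compose_inv[OF bij p] map_permutation_permutes[OF bij p] gf by auto
    have "(\<Prod>a\<in>S. f a (map_permutation ?I (pick S) p a)) = (\<Prod>i\<in>?I. f (pick S i) (map_permutation ?I (pick S) p (pick S i)))"
      by (rule prod.reindex_bij_betw[OF bij, symmetric])
    also have "\<dots> = (\<Prod>i\<in>?I. f (pick S i) (pick S (p i)))"
      by (intro prod.cong refl) (simp add: map_permutation_apply[OF inj])
    finally show "of_int (sign (map_permutation ?I (pick S) p)) * (\<Prod>a\<in>S. f a (map_permutation ?I (pick S) p a))
        = of_int (sign p) * (\<Prod>i\<in>?I. f (pick S i) (pick S (p i)))"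
      by (simp add: sign_map_permutation[OF inj p])
  qed
  then show ?thesis unfolding row_det_row_mask[OF assms] unfolding row_det_leibniz .
qed

definition char_pencil :: "(nat \<Rightarrow> nat \<Rightarrow> complex) \<Rightarrow> nat \<Rightarrow> nat \<Rightarrow> complex poly" where
  "char_pencil M a b = [:- M a b, of_bool (a = b):]"

lemma char_poly_submatrix:
  assumes A: "A \<in> carrier_mat n n" and S: "S \<subseteq> {..<n}"
  shows "char_poly (submatrix A S S) = row_det n (row_mask S (char_pencil (\<lambda>a b. A $$ (a, b))))"
    and "degree (char_poly (submatrix A S S)) = card S"
    and "lead_coeff (char_poly (submatrix A S S)) = 1"
proof -
  have fin: "finite S" using S finite_subset by blast
  have eq: "{i. i < n \<and> i \<in> S} = S" using S by auto
  have carr: "submatrix A S S \<in> carrier_mat (card S) (card S)"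
    using A by (auto simp: submatrix_def eq)
  show "degree (char_poly (submatrix A S S)) = card S" "lead_coeff (char_poly (submatrix A S S)) = 1"
    using degree_monic_char_poly[OF carr] by auto
  have inj: "inj_on (pick S) {..<card S}" using bij_betw_pick[OF fin] by (rule bij_betw_imp_inj_on)
  have "char_poly_matrix (submatrix A S S) = mat (card S) (card S) (\<lambda>(i, l). char_pencil (\<lambda>a b. A $$ (a, b)) (pick S i) (pick S l))"
    using A inj by (intro eq_matI) (auto simp: char_poly_matrix_def submatrix_def eq char_pencil_def inj_on_eq_iff)
  then have "char_poly (submatrix A S S) = row_det (card S) (\<lambda>i l. char_pencil (\<lambda>a b. A $$ (a, b)) (pick S i) (pick S l))"
    by (simp add: char_poly_def row_det_def)
  also have "\<dots> = row_det n (row_mask S (char_pencil (\<lambda>a b. A $$ (a, b))))"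
    by (rule row_det_pick[OF S])
  finally show "char_poly (submatrix A S S) = row_det n (row_mask S (char_pencil (\<lambda>a b. A $$ (a, b))))" .
qed

section \<open>Sums over all colourings and their adjugates\<close>

definition colour_class :: "nat \<Rightarrow> (nat \<Rightarrow> nat) \<Rightarrow> nat \<Rightarrow> nat set" where
  "colour_class n c i = {a. a < n \<and> c a = i}"

lemma colour_class_subset: "colour_class n c i \<subseteq> {..<n}"
  by (auto simp: colour_class_def)

lemma finite_colour_class [simp]: "finite (colour_class n c i)"
  by (simp add: colour_class_def)

lemma sum_card_colour_class:
  assumes "finite K" "c \<in> {..<n} \<rightarrow>\<^sub>E K"
  shows "(\<Sum>i\<in>K. card (colour_class n c i)) = n"
proof -
  have "(\<Sum>i\<in>K. card (colour_class n c i)) = (\<Sum>i\<in>K. \<Sum>a | a \<in> {..<n} \<and> c a = i. 1)"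
    by (simp add: colour_class_def)
  also have "\<dots> = (\<Sum>a<n. 1)" by (rule sum.group) (use assms in auto)
  finally show ?thesis by simp
qed

text \<open>The sum is left unnormalized, since the factor k^n affects neither roots nor quotients.
  The entry type is general, so that the same sum is used for complex matrices and for polynomial
  pencils.\<close>

definition colour_dets :: "nat \<Rightarrow> nat set \<Rightarrow> (nat \<Rightarrow> nat \<Rightarrow> nat \<Rightarrow> 'a) \<Rightarrow> 'a::comm_ring_1" where
  "colour_dets n K C = (\<Sum>c\<in>{..<n} \<rightarrow>\<^sub>E K. \<Prod>i\<in>K. row_det n (row_mask (colour_class n c i) (C i)))"

text \<open>\<open>marked_dets n K j C\<close> is the sum of the adjugates of the \<open>j\<close>-th factors, restricted to the class
  of colour \<open>j\<close>; no condition on the colour of \<open>a\<close> is needed, since the determinant has two equal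
  rows when \<open>a\<close> lies outside that class.\<close>

definition marked_dets :: "nat \<Rightarrow> nat set \<Rightarrow> nat \<Rightarrow> (nat \<Rightarrow> nat \<Rightarrow> nat \<Rightarrow> 'a) \<Rightarrow> nat \<Rightarrow> nat \<Rightarrow> 'a::comm_ring_1" where
  "marked_dets n K j C a b = (\<Sum>c\<in>{..<n} \<rightarrow>\<^sub>E K. if c b = j
     then row_det n ((row_mask (colour_class n c j) (C j))(b := unit_row a)) *
       (\<Prod>i\<in>K - {j}. row_det n (row_mask (colour_class n c i) (C i)))
     else 0)"

lemma colour_dets_nonzero:
  assumes "finite K" "K \<noteq> {}" "\<And>i. i \<in> K \<Longrightarrow> positive_imaginary n (C i)"
  shows "colour_dets n K C \<noteq> 0"
proof -
  have "colour_dets n K C = colour_sum n K {..<n} {} C"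
    unfolding colour_dets_def colour_sum_def colour_class_def by simp
  then show ?thesis using colour_sum_nonzero[of K "{..<n}" "{}" n C] assms by simp
qed

lemma row_det_row_mask_rank_one:
  assumes "S \<subseteq> {..<n}"
  shows "row_det n (row_mask S (\<lambda>a l. M a l + u a * w l)) = row_det n (row_mask S M) +
    (\<Sum>a<n. \<Sum>b<n. w a * (if b \<in> S then row_det n ((row_mask S M)(b := unit_row a)) else 0) * u b)"
proof -
  let ?r = "row_mask S M"
  have "row_det n (row_mask S (\<lambda>a l. M a l + u a * w l)) = row_det n (\<lambda>a l. ?r a l + (if a \<in> S then u a else 0) * w l)"
    by (rule row_det_cong) (simp add: row_mask_def)
  also have "\<dots> = row_det n ?r + (\<Sum>b<n. (if b \<in> S then u b else 0) * row_det n (?r(b := w)))"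
    by (rule row_det_rank_one)
  also have "(\<Sum>b<n. (if b \<in> S then u b else 0) * row_det n (?r(b := w)))
      = (\<Sum>b<n. \<Sum>a<n. w a * (if b \<in> S then row_det n (?r(b := unit_row a)) else 0) * u b)"
  proof (intro sum.cong refl)
    fix b assume "b \<in> {..<n}"
    then have b: "b < n" by simp
    have "row_det n (?r(b := w)) = row_det n (?r(b := \<lambda>l. \<Sum>a<n. w a * unit_row a l))"
      by (rule row_det_cong) (simp add: unit_row_def)
    also have "\<dots> = (\<Sum>a<n. w a * row_det n (?r(b := unit_row a)))" by (rule row_det_linear[OF b])
    finally show "(if b \<in> S then u b else 0) * row_det n (?r(b := w))
      = (\<Sum>a<n. w a * (if b \<in> S then row_det n (?r(b := unit_row a)) else 0) * u b)"
      by (simp add: sum_distrib_left mult_ac)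
  qed
  also have "\<dots> = (\<Sum>a<n. \<Sum>b<n. w a * (if b \<in> S then row_det n (?r(b := unit_row a)) else 0) * u b)"
    by (rule sum.swap)
  finally show ?thesis .
qed

text \<open>Only the j-th factor changes, and in it only rows of colour \<open>j\<close>. Since the
  determinant of a rank-one update is affine, the change is exactly a sesquilinear expression in
  \<open>marked_dets\<close> when \<open>w\<close> is the conjugate of a multiple of
  \<open>u\<close>.\<close>

lemma colour_dets_rank_one:
  assumes "finite K" "j \<in> K"
  shows "colour_dets n K (C(j := \<lambda>a l. C j a l + u a * w l)) =
    colour_dets n K C + (\<Sum>a<n. \<Sum>b<n. w a * marked_dets n K j C a b * u b)"
proof -
  define D where "D c i = row_det n (row_mask (colour_class n c i) (C i))" for c i
  define X where "X c a b = row_det n ((row_mask (colour_class n c j) (C j))(b := unit_row a))" for c a b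
  have "(\<Prod>i\<in>K. row_det n (row_mask (colour_class n c i) ((C(j := \<lambda>a l. C j a l + u a * w l)) i)))
     = (\<Prod>i\<in>K. D c i) + (\<Sum>a<n. \<Sum>b<n. w a * (if c b = j then X c a b * (\<Prod>i\<in>K - {j}. D c i) else 0) * u b)" for c
  proof -
    have "(\<Prod>i\<in>K. row_det n (row_mask (colour_class n c i) ((C(j := \<lambda>a l. C j a l + u a * w l)) i)))
      = row_det n (row_mask (colour_class n c j) (\<lambda>a l. C j a l + u a * w l)) * (\<Prod>i\<in>K - {j}. D c i)"
      unfolding D_def using assms by (subst prod.remove[of _ j]) auto
    also have "row_det n (row_mask (colour_class n c j) (\<lambda>a l. C j a l + u a * w l)) = D c j +
        (\<Sum>a<n. \<Sum>b<n. w a * (if b \<in> colour_class n c j then X c a b else 0) * u b)"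
      unfolding D_def X_def by (rule row_det_row_mask_rank_one[OF colour_class_subset])
    also have "(\<Sum>a<n. \<Sum>b<n. w a * (if b \<in> colour_class n c j then X c a b else 0) * u b)
       = (\<Sum>a<n. \<Sum>b<n. w a * (if c b = j then X c a b else 0) * u b)"
      by (intro sum.cong refl) (simp add: colour_class_def)
    also have "(D c j + (\<Sum>a<n. \<Sum>b<n. w a * (if c b = j then X c a b else 0) * u b)) * (\<Prod>i\<in>K - {j}. D c i)
       = D c j * (\<Prod>i\<in>K - {j}. D c i) + (\<Sum>a<n. \<Sum>b<n. w a * (if c b = j then X c a b * (\<Prod>i\<in>K - {j}. D c i) else 0) * u b)"
      unfolding distrib_right sum_distrib_right
      by (intro arg_cong2[where f = "(+)"] sum.cong refl) (simp add: mult_ac)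
    also have "D c j * (\<Prod>i\<in>K - {j}. D c i) = (\<Prod>i\<in>K. D c i)"
      using assms by (subst prod.remove[of _ j]) auto
    finally show ?thesis .
  qed
  then have "colour_dets n K (C(j := \<lambda>a l. C j a l + u a * w l)) = (\<Sum>c\<in>{..<n} \<rightarrow>\<^sub>E K. \<Prod>i\<in>K. D c i) +
     (\<Sum>c\<in>{..<n} \<rightarrow>\<^sub>E K. \<Sum>a<n. \<Sum>b<n. w a * (if c b = j then X c a b * (\<Prod>i\<in>K - {j}. D c i) else 0) * u b)"
    unfolding colour_dets_def by (simp only: sum.distrib)
  also have "(\<Sum>c\<in>{..<n} \<rightarrow>\<^sub>E K. \<Sum>a<n. \<Sum>b<n. w a * (if c b = j then X c a b * (\<Prod>i\<in>K - {j}. D c i) else 0) * u b)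
     = (\<Sum>a<n. \<Sum>c\<in>{..<n} \<rightarrow>\<^sub>E K. \<Sum>b<n. w a * (if c b = j then X c a b * (\<Prod>i\<in>K - {j}. D c i) else 0) * u b)"
    by (rule sum.swap)
  also have "\<dots> = (\<Sum>a<n. \<Sum>b<n. \<Sum>c\<in>{..<n} \<rightarrow>\<^sub>E K. w a * (if c b = j then X c a b * (\<Prod>i\<in>K - {j}. D c i) else 0) * u b)"
    by (rule sum.cong[OF refl], rule sum.swap)
  also have "\<dots> = (\<Sum>a<n. \<Sum>b<n. w a * marked_dets n K j C a b * u b)"
    unfolding marked_dets_def sum_distrib_left sum_distrib_right D_def X_def ..
  finally show ?thesis unfolding colour_dets_def D_def .
qed

text \<open>This is xI - H - w v v^*; the imaginary part of its form at u is Im x |u|^2 - Im w |v^*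
  u|^2, because the Hermitian \<open>H\<close> contributes a real number.\<close>

lemma positive_imaginary_pencil:
  assumes H: "\<And>a b. a < n \<Longrightarrow> b < n \<Longrightarrow> H b a = cnj (H a b)" and x: "Im x > 0" and w: "Im w \<le> 0"
  shows "positive_imaginary n (\<lambda>a b. x * of_bool (a = b) - H a b + (- w * v a) * cnj (v b))"
  unfolding positive_imaginary_def
proof (intro allI impI)
  fix u :: "nat \<Rightarrow> complex" assume u: "\<exists>a<n. u a \<noteq> 0"
  define N where "N = (\<Sum>a<n. (cmod (u a))\<^sup>2)"
  define s where "s = (\<Sum>b<n. cnj (v b) * u b)"
  have "N > 0" using u unfolding N_def by (auto intro!: sum_pos2)
  have "herm_form n (\<lambda>a b. x * of_bool (a = b) - H a b + (- w * v a) * cnj (v b)) u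
     = (\<Sum>a<n. \<Sum>b<n. (x * (cnj (u a) * u b)) * of_bool (a = b)) - herm_form n H u
       - (\<Sum>a<n. \<Sum>b<n. (w * (cnj (u a) * v a)) * (cnj (v b) * u b))"
    unfolding herm_form_def sum_subtractf[symmetric] by (intro sum.cong refl) (simp add: algebra_simps)
  also have "(\<Sum>a<n. \<Sum>b<n. (x * (cnj (u a) * u b)) * of_bool (a = b)) = (\<Sum>a<n. x * (cnj (u a) * u a))"
    by (intro sum.cong refl) simp
  also have "\<dots> = x * of_real N"
    unfolding N_def of_real_sum sum_distrib_left
    by (intro sum.cong refl) (simp only: complex_norm_square mult.commute)
  also have "(\<Sum>a<n. \<Sum>b<n. (w * (cnj (u a) * v a)) * (cnj (v b) * u b)) = w * (cnj s * s)"
    unfolding s_def by (simp add: sum_distrib_left sum_distrib_right mult_ac)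
  also have "cnj s * s = of_real ((cmod s)\<^sup>2)"
    by (simp only: complex_norm_square mult.commute)
  finally have 1: "Im (herm_form n (\<lambda>a b. x * of_bool (a = b) - H a b + (- w * v a) * cnj (v b)) u)
    = Im x * N - Im (herm_form n H u) - Im w * (cmod s)\<^sup>2"
    by (simp only: minus_complex.sel times_complex.sel Re_complex_of_real Im_complex_of_real)
  have "cnj (herm_form n H u) = (\<Sum>a<n. \<Sum>b<n. cnj (u b) * H b a * u a)"
    unfolding herm_form_def cnj_sum
  proof (intro sum.cong refl)
    fix a b assume "a \<in> {..<n}" "b \<in> {..<n}"
    then have "H b a = cnj (H a b)" by (intro H) auto
    then show "cnj (cnj (u a) * H a b * u b) = cnj (u b) * H b a * u a" by simp
  qed
  also have "\<dots> = herm_form n H u" unfolding herm_form_def by (rule sum.swap)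
  finally have "Im (herm_form n H u) = 0" by (metis Reals_cnj_iff complex_is_Real_iff)
  moreover have "Im x * N > 0" using x \<open>N > 0\<close> by simp
  moreover have "Im w * (cmod s)\<^sup>2 \<le> 0" using w by (simp add: mult_nonpos_nonneg)
  ultimately show "0 < Im (herm_form n (\<lambda>a b. x * of_bool (a = b) - H a b + (- w * v a) * cnj (v b)) u)"
    unfolding 1 by simp
qed

lemma colour_dets_pencil_nonzero:
  assumes "finite K" "K \<noteq> {}" "Im x > 0"
    and "\<And>i a b. i \<in> K \<Longrightarrow> a < n \<Longrightarrow> b < n \<Longrightarrow> H i b a = cnj (H i a b)"
  shows "colour_dets n K (\<lambda>i a b. x * of_bool (a = b) - H i a b) \<noteq> 0"
proof (rule colour_dets_nonzero[OF assms(1,2)])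
  fix i assume "i \<in> K"
  from positive_imaginary_pencil[OF assms(4)[OF this] assms(3), where w = 0 and v = "\<lambda>_. 0"]
  show "positive_imaginary n (\<lambda>a b. x * of_bool (a = b) - H i a b)" by simp
qed

lemma marked_dets_herglotz:
  assumes "finite K" "j \<in> K" "Im x > 0"
    and H: "\<And>i a b. i \<in> K \<Longrightarrow> a < n \<Longrightarrow> b < n \<Longrightarrow> H i b a = cnj (H i a b)"
  defines "C \<equiv> \<lambda>i a b. x * of_bool (a = b) - H i a b"
  shows "Im (herm_form n (marked_dets n K j C) v / colour_dets n K C) \<le> 0"
proof -
  define q where "q = colour_dets n K C"
  define f where "f = herm_form n (marked_dets n K j C) v"
  have q: "q \<noteq> 0" unfolding q_def C_def by (rule colour_dets_pencil_nonzero[OF assms(1) _ assms(3) H]) (use assms(2) in auto)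
  have ne: "q - w * f \<noteq> 0" if w: "Im w \<le> 0" for w
  proof -
    have "colour_dets n K (C(j := \<lambda>a l. C j a l + (- w * v a) * cnj (v l))) \<noteq> 0"
    proof (rule colour_dets_nonzero)
      fix i assume i: "i \<in> K"
      show "positive_imaginary n ((C(j := \<lambda>a l. C j a l + (- w * v a) * cnj (v l))) i)"
        using positive_imaginary_pencil[OF H[OF i] assms(3) w, where v = v]
          positive_imaginary_pencil[OF H[OF i] assms(3), where w = 0 and v = "\<lambda>_. 0"]
        unfolding C_def by auto
    qed (use assms(1,2) in auto)
    also have "colour_dets n K (C(j := \<lambda>a l. C j a l + (- w * v a) * cnj (v l))) =
      q + (\<Sum>a<n. \<Sum>b<n. cnj (v a) * marked_dets n K j C a b * (- w * v b))"
      unfolding q_def by (rule colour_dets_rank_one[OF assms(1,2)])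
    also have "(\<Sum>a<n. \<Sum>b<n. cnj (v a) * marked_dets n K j C a b * (- w * v b)) = - w * f"
      unfolding f_def herm_form_def sum_distrib_left by (intro sum.cong refl) simp
    finally show ?thesis by simp
  qed
  have "Im (f / q) \<le> 0"
  proof (rule ccontr)
    assume "\<not> Im (f / q) \<le> 0"
    then have 1: "Im (f / q) > 0" by simp
    then have f0: "f \<noteq> 0" by auto
    have "Im (inverse (f / q)) < 0" using 1 by (simp only: inverse_complex.sel) (auto simp: divide_neg_pos sum_power2_gt_zero_iff f0)
    \<comment> \<open>If Im (f / q) were positive, then w = q / f would be an admissible
      perturbation, and q - w f = 0 contradicts nonvanishing.\<close>
    then have "Im (q / f) \<le> 0" by simp
    from ne[OF this] show False using f0 by simp
  qed
  then show ?thesis by (simp add: f_def q_def)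
qed

section \<open>Reversed pencils and low-order coefficients\<close>

lemma row_mask_upd: "b \<in> S \<Longrightarrow> row_mask S (r(b := w)) = (row_mask S r)(b := w)"
  by (auto simp: row_mask_def)

lemma row_det_row_mask_scale:
  assumes "S \<subseteq> {..<n}"
  shows "row_det n (row_mask S (\<lambda>a l. z * C a l)) = z ^ card S * row_det n (row_mask S C)"
  unfolding row_det_row_mask[OF assms] sum_distrib_left
  by (intro sum.cong refl) (simp add: prod.distrib mult_ac)

text \<open>Row \<open>b\<close> is not scaled, so the degree of homogeneity is
  \<open>card S - 1\<close>; the extra \<open>z\<close> on the left avoids the subtraction. The same
  device appears in \<open>marked_dets_scale\<close>.\<close>

lemma row_det_row_mask_upd_scale:
  assumes "S \<subseteq> {..<n}" "b \<in> S"
  shows "z * row_det n ((row_mask S (\<lambda>a l. z * C a l))(b := w)) = z ^ card S * row_det n ((row_mask S C)(b := w))"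
proof -
  have b: "b < n" using assms by auto
  have "z * row_det n ((row_mask S (\<lambda>a l. z * C a l))(b := w)) = row_det n ((row_mask S (\<lambda>a l. z * C a l))(b := \<lambda>l. z * w l))"
    unfolding row_det_upd[OF b] sum_distrib_left by (intro sum.cong refl) (simp add: mult_ac)
  also have "(row_mask S (\<lambda>a l. z * C a l))(b := \<lambda>l. z * w l) = row_mask S (\<lambda>a l. z * (C(b := w)) a l)"
    using assms(2) by (auto simp: row_mask_def)
  also have "row_det n \<dots> = z ^ card S * row_det n (row_mask S (C(b := w)))"
    by (rule row_det_row_mask_scale[OF assms(1)])
  finally show ?thesis by (simp only: row_mask_upd[OF assms(2)])
qed

lemma colour_dets_scale:
  assumes "finite K"
  shows "colour_dets n K (\<lambda>i a l. z * C i a l) = z ^ n * colour_dets n K C"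
  unfolding colour_dets_def sum_distrib_left
proof (intro sum.cong refl)
  fix c assume c: "c \<in> {..<n} \<rightarrow>\<^sub>E K"
  have "(\<Prod>i\<in>K. row_det n (row_mask (colour_class n c i) (\<lambda>a l. z * C i a l)))
    = (\<Prod>i\<in>K. z ^ card (colour_class n c i)) * (\<Prod>i\<in>K. row_det n (row_mask (colour_class n c i) (C i)))"
    by (simp only: row_det_row_mask_scale[OF colour_class_subset] prod.distrib)
  also have "(\<Prod>i\<in>K. z ^ card (colour_class n c i)) = z ^ n"
    by (simp only: power_sum[symmetric] sum_card_colour_class[OF assms c])
  finally show "(\<Prod>i\<in>K. row_det n (row_mask (colour_class n c i) (\<lambda>a l. z * C i a l)))
    = z ^ n * (\<Prod>i\<in>K. row_det n (row_mask (colour_class n c i) (C i)))" .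
qed

lemma marked_dets_scale:
  assumes "finite K" "j \<in> K" "b < n"
  shows "(z :: 'a::comm_ring_1) * marked_dets n K j (\<lambda>i a l. z * C i a l) a b = z ^ n * marked_dets n K j C a b"
  unfolding marked_dets_def sum_distrib_left
proof (intro sum.cong refl)
  fix c assume c: "c \<in> {..<n} \<rightarrow>\<^sub>E K"
  let ?S = "colour_class n c"
  show "z * (if c b = j then row_det n ((row_mask (?S j) (\<lambda>a l. z * C j a l))(b := unit_row a)) *
       (\<Prod>i\<in>K - {j}. row_det n (row_mask (?S i) (\<lambda>a l. z * C i a l))) else 0)
    = z ^ n * (if c b = j then row_det n ((row_mask (?S j) (C j))(b := unit_row a)) *
       (\<Prod>i\<in>K - {j}. row_det n (row_mask (?S i) (C i))) else 0)"
  proof (cases "c b = j")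
    case True
    then have b: "b \<in> ?S j" using assms(3) by (simp add: colour_class_def)
    have 1: "(\<Prod>i\<in>K - {j}. row_det n (row_mask (?S i) (\<lambda>a l. z * C i a l)))
      = (\<Prod>i\<in>K - {j}. z ^ card (?S i)) * (\<Prod>i\<in>K - {j}. row_det n (row_mask (?S i) (C i)))"
      by (simp only: row_det_row_mask_scale[OF colour_class_subset] prod.distrib)
    have "z ^ card (?S j) * (\<Prod>i\<in>K - {j}. z ^ card (?S i)) = (\<Prod>i\<in>K. z ^ card (?S i))"
      using assms by (subst prod.remove[of _ j]) auto
    also have "\<dots> = z ^ n"
      by (simp only: power_sum[symmetric] sum_card_colour_class[OF assms(1) c])
    finally have 2: "z ^ card (?S j) * (\<Prod>i\<in>K - {j}. z ^ card (?S i)) = z ^ n" .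
    have 3: "z * (x' * q') = z ^ n * (x * q)"
      if "z * x' = y * x" "q' = p * q" "y * p = z ^ n" for x x' y p q q' :: 'a
      using that by (metis mult.assoc mult.commute)
    show ?thesis unfolding if_P[OF True]
      by (rule 3[OF row_det_row_mask_upd_scale[OF colour_class_subset b] 1 2])
  qed simp
qed

lemma poly_unit_row: "poly (unit_row a b) x = unit_row a b"
  by (simp add: unit_row_def)

lemma poly_row_mask: "poly (row_mask S R a b) x = row_mask S (\<lambda>a b. poly (R a b) x) a b"
  by (simp add: row_mask_def poly_unit_row)

lemma poly_colour_dets:
  "poly (colour_dets n K R) x = colour_dets n K (\<lambda>i a b. poly (R i a b) x)"
  unfolding colour_dets_def poly_sum poly_prod row_det_poly poly_row_mask ..

lemma poly_marked_dets:
  "poly (marked_dets n K j R a b) x = marked_dets n K j (\<lambda>i a b. poly (R i a b) x) a b"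
  unfolding marked_dets_def poly_sum
proof (intro sum.cong refl)
  fix c
  have "(\<lambda>u l. poly (((row_mask (colour_class n c j) (R j))(b := unit_row a)) u l) x)
    = (row_mask (colour_class n c j) (\<lambda>u l. poly (R j u l) x))(b := unit_row a)"
    by (intro ext) (simp add: poly_unit_row poly_row_mask)
  then show "poly (if c b = j then row_det n ((row_mask (colour_class n c j) (R j))(b := unit_row a)) *
       (\<Prod>i\<in>K - {j}. row_det n (row_mask (colour_class n c i) (R i))) else 0) x
    = (if c b = j then row_det n ((row_mask (colour_class n c j) (\<lambda>a b. poly (R j a b) x))(b := unit_row a)) *
       (\<Prod>i\<in>K - {j}. row_det n (row_mask (colour_class n c i) (\<lambda>a b. poly (R i a b) x))) else 0)"
    by (simp add: poly_prod row_det_poly poly_row_mask)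
qed

text \<open>Row \<open>b\<close> of the j-th factor is constant, so one degree is lost against the
  total n. Strictness means that the partial fractions of N / q have no polynomial part.\<close>

lemma degree_marked_dets:
  assumes "finite K" "j \<in> K" "a < n" "b < n"
  shows "degree (marked_dets n K j (\<lambda>i. char_pencil (A i)) a b) < n"
proof -
  have "degree (marked_dets n K j (\<lambda>i. char_pencil (A i)) a b) \<le> n - 1"
    unfolding marked_dets_def
  proof (rule degree_sum_le)
    show "finite ({..<n} \<rightarrow>\<^sub>E K)" using assms(1) by (simp add: finite_PiE)
    fix c assume c: "c \<in> {..<n} \<rightarrow>\<^sub>E K"
    let ?S = "colour_class n c"
    let ?R = "\<lambda>i. row_mask (?S i) (char_pencil (A i))"
    show "degree (if c b = j then row_det n ((?R j)(b := unit_row a)) * (\<Prod>i\<in>K - {j}. row_det n (?R i)) else 0) \<le> n - 1"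
    proof (cases "c b = j")
      case True
      then have b: "b \<in> ?S j" using assms(4) by (simp add: colour_class_def)
      have sum: "(\<Sum>a<n. of_bool (a \<in> S)) = card S" if "S \<subseteq> {..<n}" for S :: "nat set"
        using that by (simp add: Int_absorb1)
      have "degree (row_det n ((?R j)(b := unit_row a))) \<le> (\<Sum>u<n. of_bool (u \<in> ?S j - {b}))"
        by (rule row_det_degree) (auto simp: row_mask_def unit_row_def char_pencil_def)
      also have "\<dots> = card (?S j) - 1"
        by (subst sum) (use b colour_class_subset in auto)
      finally have 1: "degree (row_det n ((?R j)(b := unit_row a))) \<le> card (?S j) - 1" .
      have "degree (row_det n (?R i)) \<le> (\<Sum>u<n. of_bool (u \<in> ?S i))" for i
        by (rule row_det_degree) (auto simp: row_mask_def unit_row_def char_pencil_def)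
      then have 2: "degree (row_det n (?R i)) \<le> card (?S i)" for i
        by (simp only: sum[OF colour_class_subset])
      have "degree (\<Prod>i\<in>K - {j}. row_det n (?R i)) \<le> (\<Sum>i\<in>K - {j}. degree (row_det n (?R i)))"
        using degree_prod_sum_le[of "K - {j}" "\<lambda>i. row_det n (?R i)"] assms(1) by (simp add: o_def)
      also have "\<dots> \<le> (\<Sum>i\<in>K - {j}. card (?S i))" using 2 by (intro sum_mono)
      finally have 3: "degree (\<Prod>i\<in>K - {j}. row_det n (?R i)) \<le> (\<Sum>i\<in>K - {j}. card (?S i))" .
      have "card (?S j) + (\<Sum>i\<in>K - {j}. card (?S i)) = n"
        using sum_card_colour_class[OF assms(1) c] assms(1,2) by (simp add: sum.remove)
      moreover have "card (?S j) \<noteq> 0" using b by auto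
      ultimately have "card (?S j) - 1 + (\<Sum>i\<in>K - {j}. card (?S i)) = n - 1" by linarith
      moreover have "degree (row_det n ((?R j)(b := unit_row a)) * (\<Prod>i\<in>K - {j}. row_det n (?R i)))
        \<le> card (?S j) - 1 + (\<Sum>i\<in>K - {j}. card (?S i))"
        by (rule order.trans[OF degree_mult_le add_mono[OF 1 3]])
      ultimately show ?thesis using True by simp
    qed simp
  qed
  then show ?thesis using assms(3) by linarith
qed

text \<open>The pencil I - tM. With t = 1 / x it equals (xI - M) / x, so expansions at x =
  \<infinity> become Taylor coefficients at t = 0.\<close>

definition reverse_pencil :: "(nat \<Rightarrow> nat \<Rightarrow> complex) \<Rightarrow> nat \<Rightarrow> nat \<Rightarrow> complex poly" where
  "reverse_pencil M a b = [:of_bool (a = b), - M a b:]"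

lemma poly_colour_dets_reverse:
  assumes "finite K" "x \<noteq> 0"
  shows "poly (colour_dets n K (\<lambda>i. char_pencil (A i))) x
    = x ^ n * poly (colour_dets n K (\<lambda>i. reverse_pencil (A i))) (1 / x)"
proof -
  have "(\<lambda>i a b. poly (char_pencil (A i) a b) x) = (\<lambda>i a b. x * poly (reverse_pencil (A i) a b) (1 / x))"
    using assms(2) by (intro ext) (simp add: char_pencil_def reverse_pencil_def field_simps)
  then show ?thesis unfolding poly_colour_dets by (simp only: colour_dets_scale[OF assms(1)])
qed

lemma poly_marked_dets_reverse:
  assumes "finite K" "j \<in> K" "b < n" "x \<noteq> 0"
  shows "x * poly (marked_dets n K j (\<lambda>i. char_pencil (A i)) a b) x
    = x ^ n * poly (marked_dets n K j (\<lambda>i. reverse_pencil (A i)) a b) (1 / x)"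
proof -
  have "(\<lambda>i a b. poly (char_pencil (A i) a b) x) = (\<lambda>i a b. x * poly (reverse_pencil (A i) a b) (1 / x))"
    using assms(4) by (intro ext) (simp add: char_pencil_def reverse_pencil_def field_simps)
  then show ?thesis unfolding poly_marked_dets by (simp only: marked_dets_scale[OF assms(1-3)])
qed

definition rev_det :: "nat \<Rightarrow> (nat \<Rightarrow> nat \<Rightarrow> complex) \<Rightarrow> nat set \<Rightarrow> complex poly" where
  "rev_det n M S = row_det n (row_mask S (reverse_pencil M))"

definition rev_adj :: "nat \<Rightarrow> (nat \<Rightarrow> nat \<Rightarrow> complex) \<Rightarrow> nat set \<Rightarrow> nat \<Rightarrow> nat \<Rightarrow> complex poly" where
  "rev_adj n M S a b = row_det n ((row_mask S (reverse_pencil M))(b := unit_row a))"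

lemma rev_adj_outside: "a < n \<Longrightarrow> a \<notin> S \<Longrightarrow> b < n \<Longrightarrow> b \<in> S \<Longrightarrow> rev_adj n M S a b = 0"
  unfolding rev_adj_def by (rule row_det_equal_rows[of a _ b]) (auto simp: row_mask_def)

text \<open>Putting the unit row at \<open>b\<close> into row \<open>b\<close> is the same as
  masking \<open>b\<close>. This identity drives the inductions over \<open>S\<close> that compute
  coefficients of \<open>rev_det\<close>.\<close>

lemma rev_adj_diag: "rev_adj n M S b b = rev_det n M (S - {b})"
  unfolding rev_adj_def rev_det_def by (rule arg_cong[where f = "row_det n"]) (auto simp: row_mask_def)

text \<open>The identity (I - tM) adj = det I, solved for adj. The factor t in front of M adj
  determines each coefficient by those of lower order and those of the determinant.\<close>

lemma rev_adj_recursion: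
  assumes "S \<subseteq> {..<n}" "a \<in> S" "b \<in> S"
  shows "rev_adj n M S a b = (if a = b then rev_det n M S else 0) + (\<Sum>l<n. pCons 0 (smult (M a l) (rev_adj n M S l b)))"
proof -
  have ab: "a < n" "b < n" using assms by auto
  have "(\<Sum>l<n. row_mask S (reverse_pencil M) a l * rev_adj n M S l b) = (if a = b then rev_det n M S else 0)"
    unfolding rev_adj_def rev_det_def by (rule adjugate_identity[OF ab])
  moreover have "row_mask S (reverse_pencil M) a l * rev_adj n M S l b =
     (if l = a then rev_adj n M S l b else 0) - pCons 0 (smult (M a l) (rev_adj n M S l b))" for l
    using assms(2) by (auto simp: row_mask_def reverse_pencil_def)
  ultimately have "(\<Sum>l<n. if l = a then rev_adj n M S l b else 0) - (\<Sum>l<n. pCons 0 (smult (M a l) (rev_adj n M S l b)))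
     = (if a = b then rev_det n M S else 0)"
    by (simp add: sum_subtractf)
  then show ?thesis using ab by (simp add: algebra_simps)
qed

lemma coeff_rev_det_0: "coeff (rev_det n M S) 0 = 1"
proof -
  have "(\<lambda>a b. poly (row_mask S (reverse_pencil M) a b) 0) = unit_row"
    by (intro ext) (simp add: row_mask_def reverse_pencil_def unit_row_def)
  then show ?thesis unfolding rev_det_def by (simp add: row_det_poly flip: poly_0_coeff_0)
qed

lemma coeff_rev_adj_0:
  assumes "S \<subseteq> {..<n}" "a \<in> S" "b \<in> S"
  shows "coeff (rev_adj n M S a b) 0 = of_bool (a = b)"
  by (subst rev_adj_recursion[OF assms]) (simp add: coeff_sum coeff_rev_det_0)

lemma coeff_rev_adj_Suc:
  assumes "S \<subseteq> {..<n}" "a \<in> S" "b \<in> S"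
  shows "coeff (rev_adj n M S a b) (Suc m) = (if a = b then coeff (rev_det n M S) (Suc m) else 0)
    + (\<Sum>l\<in>S. M a l * coeff (rev_adj n M S l b) m)"
proof -
  have "coeff (rev_adj n M S a b) (Suc m) = (if a = b then coeff (rev_det n M S) (Suc m) else 0)
    + (\<Sum>l<n. M a l * coeff (rev_adj n M S l b) m)"
    by (subst rev_adj_recursion[OF assms]) (simp add: coeff_sum)
  also have "(\<Sum>l<n. M a l * coeff (rev_adj n M S l b) m) = (\<Sum>l\<in>S. M a l * coeff (rev_adj n M S l b) m)"
    using assms by (intro sum.mono_neutral_right) (auto simp: rev_adj_outside)
  finally show ?thesis .
qed

lemma coeff_rev_adj_1_aux:
  assumes "S \<subseteq> {..<n}" "a \<in> S" "b \<in> S"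
  shows "coeff (rev_adj n M S a b) 1 = (if a = b then coeff (rev_det n M S) 1 else 0) + M a b"
proof -
  have fin: "finite S" using assms(1) finite_subset by blast
  have "(\<Sum>l\<in>S. M a l * coeff (rev_adj n M S l b) 0) = (\<Sum>l\<in>S. M a l * of_bool (l = b))"
    using assms by (intro sum.cong refl) (simp add: coeff_rev_adj_0)
  also have "\<dots> = M a b" using assms fin by simp
  finally show ?thesis using coeff_rev_adj_Suc[OF assms, where m = 0] by simp
qed

lemma rev_det_empty: "rev_det n M {} = 1"
proof -
  have "row_mask {} (reverse_pencil M) = unit_row" by (auto simp: row_mask_def)
  then show ?thesis unfolding rev_det_def by simp
qed

context
  fixes n :: nat and M :: "nat \<Rightarrow> nat \<Rightarrow> complex"
  assumes zero_diag: "\<And>a. a < n \<Longrightarrow> M a a = 0"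
begin

text \<open>The diagonal adjugate entry is computed twice, by the recursion and as the minor of
  \<open>S\<close> without \<open>b\<close>; comparing gives the step of the induction. In general
  the coefficient is minus the trace.\<close>

lemma coeff_rev_det_1:
  assumes "S \<subseteq> {..<n}"
  shows "coeff (rev_det n M S) 1 = 0"
proof -
  have "finite S" using assms finite_subset by blast
  then show ?thesis using assms
  proof (induction S rule: finite_induct)
    case (insert b S)
    have "coeff (rev_adj n M (insert b S) b b) 1 = coeff (rev_det n M (insert b S)) 1 + M b b"
      using coeff_rev_adj_1_aux[OF insert.prems, of b b M] by simp
    moreover have "rev_adj n M (insert b S) b b = rev_det n M S" using insert.hyps by (simp add: rev_adj_diag)
    ultimately show ?case using insert zero_diag by simp
  qed (simp add: rev_det_empty)
qed

lemma coeff_rev_adj_1: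
  assumes "S \<subseteq> {..<n}" "a \<in> S" "b \<in> S"
  shows "coeff (rev_adj n M S a b) 1 = M a b"
  using coeff_rev_adj_1_aux[OF assms] coeff_rev_det_1[OF assms(1)] by simp

lemma coeff_rev_adj_2:
  assumes "S \<subseteq> {..<n}" "a \<in> S" "b \<in> S"
  shows "coeff (rev_adj n M S a b) 2 = (if a = b then coeff (rev_det n M S) 2 else 0) + (\<Sum>l\<in>S. M a l * M l b)"
proof -
  have "(\<Sum>l\<in>S. M a l * coeff (rev_adj n M S l b) 1) = (\<Sum>l\<in>S. M a l * M l b)"
    using assms by (intro sum.cong refl) (simp only: coeff_rev_adj_1)
  then show ?thesis using coeff_rev_adj_Suc[OF assms, where m = 1] by (simp add: numeral_2_eq_2)
qed

text \<open>The same comparison of diagonal adjugate entries. The value is -1/2 times the trace of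
  M[S]^2, the second elementary symmetric function of eigenvalues with sum 0.\<close>

lemma coeff_rev_det_2:
  assumes "S \<subseteq> {..<n}"
  shows "coeff (rev_det n M S) 2 = - (\<Sum>a\<in>S. \<Sum>b\<in>S. M a b * M b a) / 2"
proof -
  have "finite S" using assms finite_subset by blast
  then show ?thesis using assms
  proof (induction S rule: finite_induct)
    case (insert b S)
    have "coeff (rev_adj n M (insert b S) b b) 2 = coeff (rev_det n M (insert b S)) 2 + (\<Sum>l\<in>insert b S. M b l * M l b)"
      using coeff_rev_adj_2[OF insert.prems, of b b] by simp
    moreover have "rev_adj n M (insert b S) b b = rev_det n M S" using insert.hyps by (simp add: rev_adj_diag)
    ultimately have "coeff (rev_det n M (insert b S)) 2 = coeff (rev_det n M S) 2 - (\<Sum>l\<in>S. M b l * M l b)"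
      using insert.hyps insert.prems zero_diag by (simp add: eq_diff_eq)
    \<comment> \<open>The double sum counts each pair {b, l} in both orders, which explains the
      factor 2 here and the division by 2 in the claim.\<close>
    moreover have "(\<Sum>a\<in>insert b S. \<Sum>l\<in>insert b S. M a l * M l a)
       = (\<Sum>a\<in>S. \<Sum>l\<in>S. M a l * M l a) + 2 * (\<Sum>l\<in>S. M b l * M l b)"
      using insert.hyps insert.prems zero_diag by (simp add: sum.distrib mult.commute)
    moreover have "coeff (rev_det n M S) 2 = - (\<Sum>a\<in>S. \<Sum>b\<in>S. M a b * M b a) / 2"
      using insert by blast
    moreover have "- t / 2 - s = - (t + 2 * s) / 2" for s t :: complex by (simp add: field_simps)
    ultimately show ?case by (simp only:)
  qed (simp add: rev_det_empty)
qed

end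

section \<open>Averages over colourings\<close>

definition colour_mean :: "nat \<Rightarrow> nat set \<Rightarrow> ((nat \<Rightarrow> nat) \<Rightarrow> complex) \<Rightarrow> complex" where
  "colour_mean n K f = (\<Sum>c\<in>{..<n} \<rightarrow>\<^sub>E K. f c) / of_nat (card K) ^ n"

lemma colour_mean_add: "colour_mean n K (\<lambda>c. f c + g c) = colour_mean n K f + colour_mean n K g"
  by (simp add: colour_mean_def sum.distrib add_divide_distrib)

lemma colour_mean_minus: "colour_mean n K (\<lambda>c. - f c) = - colour_mean n K f"
  by (simp add: colour_mean_def sum_negf)

lemma colour_mean_mult: "colour_mean n K (\<lambda>c. z * f c) = z * colour_mean n K f"
  by (simp add: colour_mean_def sum_distrib_left)

lemma colour_mean_sum: "colour_mean n K (\<lambda>c. \<Sum>x\<in>X. f x c) = (\<Sum>x\<in>X. colour_mean n K (f x))"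
  unfolding colour_mean_def by (subst sum.swap) (simp add: sum_divide_distrib)

lemma colour_mean_cong:
  "(\<And>c. c \<in> {..<n} \<rightarrow>\<^sub>E K \<Longrightarrow> f c = g c) \<Longrightarrow> colour_mean n K f = colour_mean n K g"
  by (simp add: colour_mean_def)

text \<open>Independence of the colours: the indicator is a product of functions of single colours,
  so the sum over colourings factors, and each index outside \<open>F\<close> contributes
  \<open>card K\<close>, which the normalization cancels.\<close>

lemma colour_mean_event:
  assumes K: "finite K" "K \<noteq> {}" and F: "F \<subseteq> {..<n}" and g: "\<And>u. u \<in> F \<Longrightarrow> g u \<in> K"
  shows "colour_mean n K (\<lambda>c. of_bool (\<forall>u\<in>F. c u = g u)) = (1 / of_nat (card K)) ^ card F"
proof -
  have fin: "finite F" using F finite_subset by blast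
  have k: "of_nat (card K) \<noteq> (0 :: complex)" using K by simp
  define h where "h u y = (if u \<in> F then of_bool (y = g u) else 1 :: complex)" for u y
  have "(\<Prod>u<n. h u (c u)) = of_bool (\<forall>u\<in>F. c u = g u)" for c
  proof -
    have "(\<Prod>u<n. h u (c u)) = (\<Prod>u\<in>F. h u (c u))"
      using F by (intro prod.mono_neutral_right) (auto simp: h_def)
    also have "\<dots> = of_bool (\<forall>u\<in>F. c u = g u)"
      using fin by (auto simp: h_def)
    finally show ?thesis .
  qed
  then have "(\<Sum>c\<in>{..<n} \<rightarrow>\<^sub>E K. of_bool (\<forall>u\<in>F. c u = g u)) = (\<Prod>u<n. \<Sum>y\<in>K. h u y)"
    using K by (subst prod_sum_PiE) auto
  also have "\<dots> = (\<Prod>u<n. if u \<in> F then 1 else of_nat (card K))"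
    using g K by (intro prod.cong refl) (auto simp: h_def)
  finally have "colour_mean n K (\<lambda>c. of_bool (\<forall>u\<in>F. c u = g u))
     = (\<Prod>u<n. if u \<in> F then 1 else of_nat (card K)) / (\<Prod>u<n. of_nat (card K))"
    by (simp add: colour_mean_def)
  also have "\<dots> = (\<Prod>u<n. if u \<in> F then 1 / of_nat (card K) else 1)"
    unfolding prod_dividef[symmetric] using k by (intro prod.cong) auto
  also have "\<dots> = (\<Prod>u\<in>F. 1 / of_nat (card K))"
    using F by (subst prod.inter_restrict[symmetric]) (auto simp: Int_absorb1)
  finally show ?thesis by simp
qed

lemma colour_mean_single:
  assumes "finite K" "i \<in> K" "u < n"
  shows "colour_mean n K (\<lambda>c. of_bool (c u = i)) = 1 / of_nat (card K)"
  using colour_mean_event[of K "{u}" n "\<lambda>_. i"] assms by auto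

lemma colour_mean_pair:
  assumes "finite K" "i \<in> K" "j \<in> K" "u < n" "v < n" "u \<noteq> v"
  shows "colour_mean n K (\<lambda>c. of_bool (c u = i \<and> c v = j)) = (1 / of_nat (card K))\<^sup>2"
proof -
  have "(\<forall>x\<in>{u, v}. c x = (if x = u then i else j)) \<longleftrightarrow> c u = i \<and> c v = j" for c
    using assms(6) by auto
  moreover have "card {u, v} = 2" using assms by simp
  moreover have "K \<noteq> {}" using assms by auto
  ultimately show ?thesis
    using colour_mean_event[of K "{u, v}" n "\<lambda>x. if x = u then i else j"] assms(1-5)
    by (simp only:) simp
qed

lemma colour_mean_triple:
  assumes "finite K" "i \<in> K" "j \<in> K" "u < n" "v < n" "b < n" "u \<noteq> v" "b \<noteq> u" "b \<noteq> v"
  shows "colour_mean n K (\<lambda>c. of_bool (c b = j \<and> c u = i \<and> c v = i)) = (1 / of_nat (card K)) ^ 3"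
proof -
  have "(\<forall>x\<in>{b, u, v}. c x = (if x = b then j else i)) \<longleftrightarrow> c b = j \<and> c u = i \<and> c v = i" for c
    using assms by auto
  moreover have "card {b, u, v} = 3" using assms by auto
  moreover have "K \<noteq> {}" using assms by auto
  ultimately show ?thesis
    using colour_mean_event[of K "{b, u, v}" n "\<lambda>x. if x = b then j else i"] assms(1-6)
    by (simp only:) simp
qed

text \<open>This is k times the covariance of the events c(b) = j and c(u) = c(v) = i. It vanishes
  by independence when \<open>b\<close> differs from \<open>u\<close> and \<open>v\<close>;
  otherwise c(b) = j just says i = j on the second event.\<close>

lemma colour_mean_triple_defect:
  assumes "finite K" "i \<in> K" "j \<in> K" "u < n" "v < n" "b < n" "u \<noteq> v"
  shows "of_nat (card K) * colour_mean n K (\<lambda>c. of_bool (c b = j \<and> c u = i \<and> c v = i))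
      - colour_mean n K (\<lambda>c. of_bool (c u = i \<and> c v = i))
    = (of_nat (card K) * of_bool (i = j) - 1) * (1 / of_nat (card K))\<^sup>2 * (of_bool (u = b) + of_bool (v = b))"
proof -
  have k: "of_nat (card K) \<noteq> (0 :: complex)" using assms by auto
  have pair: "colour_mean n K (\<lambda>c. of_bool (c u = i \<and> c v = i)) = (1 / of_nat (card K))\<^sup>2"
    using assms by (intro colour_mean_pair) auto
  show ?thesis
  proof (cases "b = u \<or> b = v")
    case True
    have "colour_mean n K (\<lambda>c. of_bool (c b = j \<and> c u = i \<and> c v = i))
        = colour_mean n K (\<lambda>c. of_bool (i = j) * of_bool (c u = i \<and> c v = i))"
    proof (rule colour_mean_cong)
      fix c :: "nat \<Rightarrow> nat"
      have "(c b = j \<and> c u = i \<and> c v = i) \<longleftrightarrow> i = j \<and> (c u = i \<and> c v = i)" using True by metis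
      then show "of_bool (c b = j \<and> c u = i \<and> c v = i) = of_bool (i = j) * (of_bool (c u = i \<and> c v = i) :: complex)"
        by (simp only: of_bool_conj)
    qed
    moreover have "of_bool (u = b) + of_bool (v = b) = (1 :: complex)" using True assms(7) by auto
    ultimately show ?thesis unfolding colour_mean_mult pair by (simp only: left_diff_distrib mult_1_left mult_1_right mult.assoc)
  next
    case False
    then have "colour_mean n K (\<lambda>c. of_bool (c b = j \<and> c u = i \<and> c v = i)) = (1 / of_nat (card K)) ^ 3"
      using assms by (intro colour_mean_triple) auto
    then show ?thesis using False k unfolding pair by (auto simp: power2_eq_square power3_eq_cube)
  qed
qed

section \<open>Low-order coefficients of the reversed sums\<close>

lemma coeff_prod_low:
  fixes f :: "'b \<Rightarrow> complex poly"
  assumes "finite I" "\<And>i. i \<in> I \<Longrightarrow> coeff (f i) 0 = 1" "\<And>i. i \<in> I \<Longrightarrow> coeff (f i) 1 = 0"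
  shows "coeff (\<Prod>i\<in>I. f i) 0 = 1" "coeff (\<Prod>i\<in>I. f i) 1 = 0"
    "coeff (\<Prod>i\<in>I. f i) 2 = (\<Sum>i\<in>I. coeff (f i) 2)"
proof -
  have "coeff (\<Prod>i\<in>I. f i) 0 = 1 \<and> coeff (\<Prod>i\<in>I. f i) 1 = 0 \<and>
    coeff (\<Prod>i\<in>I. f i) 2 = (\<Sum>i\<in>I. coeff (f i) 2)"
    using assms by (induction I rule: finite_induct) (auto simp: coeff_mult numeral_2_eq_2)
  then show "coeff (\<Prod>i\<in>I. f i) 0 = 1" "coeff (\<Prod>i\<in>I. f i) 1 = 0"
    "coeff (\<Prod>i\<in>I. f i) 2 = (\<Sum>i\<in>I. coeff (f i) 2)" by auto
qed

context
  fixes n :: nat and K :: "nat set" and A :: "nat \<Rightarrow> nat \<Rightarrow> nat \<Rightarrow> complex" and j :: nat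
  assumes fin: "finite K" and j: "j \<in> K"
    and zero_diag: "\<And>i a. i \<in> K \<Longrightarrow> a < n \<Longrightarrow> A i a a = 0"
begin

text \<open>Minus the t^2 coefficient of the product of all factors: a sum over monochromatic pairs
  of indices. The division by 2 compensates for summing over ordered pairs.\<close>

definition edge_weight :: "(nat \<Rightarrow> nat) \<Rightarrow> complex" where
  "edge_weight c = (\<Sum>i\<in>K. \<Sum>u<n. \<Sum>v<n. (A i u v * A i v u / 2) * of_bool (c u = i \<and> c v = i))"

lemma coeff_rev_det_2_colour:
  assumes "i \<in> K"
  shows "coeff (rev_det n (A i) (colour_class n c i)) 2 =
    - (\<Sum>u<n. \<Sum>v<n. (A i u v * A i v u / 2) * of_bool (c u = i \<and> c v = i))"
proof -
  let ?S = "colour_class n c i"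
  have "(\<Sum>u<n. \<Sum>v<n. (A i u v * A i v u / 2) * of_bool (c u = i \<and> c v = i))
    = (\<Sum>u\<in>?S. \<Sum>v<n. (A i u v * A i v u / 2) * of_bool (c u = i \<and> c v = i))"
    by (intro sum.mono_neutral_right) (auto simp: colour_class_def)
  also have "\<dots> = (\<Sum>u\<in>?S. \<Sum>v\<in>?S. (A i u v * A i v u / 2) * of_bool (c u = i \<and> c v = i))"
    by (rule sum.cong[OF refl], rule sum.mono_neutral_right) (auto simp: colour_class_def)
  also have "\<dots> = (\<Sum>u\<in>?S. \<Sum>v\<in>?S. A i u v * A i v u) / 2"
    unfolding sum_divide_distrib
    by (rule sum.cong[OF refl], rule sum.cong[OF refl]) (auto simp: colour_class_def)
  finally have 1: "(\<Sum>u<n. \<Sum>v<n. (A i u v * A i v u / 2) * of_bool (c u = i \<and> c v = i)) = \<dots>" .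
  have "coeff (rev_det n (A i) ?S) 2 = - (\<Sum>a\<in>?S. \<Sum>b\<in>?S. A i a b * A i b a) / 2"
    by (rule coeff_rev_det_2) (use zero_diag[OF assms] colour_class_subset in auto)
  then show ?thesis unfolding 1 by simp
qed

lemma coeff_colour_product:
  assumes "I \<subseteq> K"
  shows "coeff (\<Prod>i\<in>I. rev_det n (A i) (colour_class n c i)) 0 = 1"
    "coeff (\<Prod>i\<in>I. rev_det n (A i) (colour_class n c i)) 1 = 0"
    "coeff (\<Prod>i\<in>I. rev_det n (A i) (colour_class n c i)) 2 =
       (\<Sum>i\<in>I. coeff (rev_det n (A i) (colour_class n c i)) 2)"
proof -
  have I: "finite I" using assms fin finite_subset by blast
  have 0: "coeff (rev_det n (A i) (colour_class n c i)) 0 = 1" if "i \<in> I" for i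
    by (rule coeff_rev_det_0)
  have 1: "coeff (rev_det n (A i) (colour_class n c i)) 1 = 0" if "i \<in> I" for i
    by (rule coeff_rev_det_1[OF zero_diag colour_class_subset]) (use that assms in auto)
  show "coeff (\<Prod>i\<in>I. rev_det n (A i) (colour_class n c i)) 0 = 1"
    "coeff (\<Prod>i\<in>I. rev_det n (A i) (colour_class n c i)) 1 = 0"
    "coeff (\<Prod>i\<in>I. rev_det n (A i) (colour_class n c i)) 2 =
       (\<Sum>i\<in>I. coeff (rev_det n (A i) (colour_class n c i)) 2)"
    using coeff_prod_low[OF I 0 1] by auto
qed

lemma coeff_colour_product_2:
  "coeff (\<Prod>i\<in>K. rev_det n (A i) (colour_class n c i)) 2 = - edge_weight c"
  unfolding coeff_colour_product(3)[OF order.refl] edge_weight_def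
  by (simp add: coeff_rev_det_2_colour sum_negf)

lemma colour_dets_reverse_coeffs:
  defines "q \<equiv> colour_dets n K (\<lambda>i. reverse_pencil (A i))"
  shows "coeff q 0 = of_nat (card K) ^ n" "coeff q 1 = 0"
    "coeff q 2 = - (of_nat (card K) ^ n * colour_mean n K edge_weight)"
proof -
  have q: "q = (\<Sum>c\<in>{..<n} \<rightarrow>\<^sub>E K. \<Prod>i\<in>K. rev_det n (A i) (colour_class n c i))"
    unfolding q_def colour_dets_def rev_det_def ..
  have k: "of_nat (card K) \<noteq> (0 :: complex)" using fin j by auto
  show "coeff q 0 = of_nat (card K) ^ n"
    unfolding q coeff_sum coeff_colour_product(1)[OF order.refl] using fin by (simp add: card_funcsetE)
  show "coeff q 1 = 0"
    unfolding q coeff_sum coeff_colour_product(2)[OF order.refl] by simp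
  show "coeff q 2 = - (of_nat (card K) ^ n * colour_mean n K edge_weight)"
    unfolding q coeff_sum coeff_colour_product_2 using k by (simp add: sum_negf colour_mean_def)
qed

definition marked_term :: "nat \<Rightarrow> nat \<Rightarrow> (nat \<Rightarrow> nat) \<Rightarrow> complex poly" where
  "marked_term a b c = (if c b = j then rev_adj n (A j) (colour_class n c j) a b *
       (\<Prod>i\<in>K - {j}. rev_det n (A i) (colour_class n c i)) else 0)"

lemma coeff_marked_term:
  assumes "a < n" "b < n"
  shows "coeff (marked_term a b c) 0 = of_bool (a = b) * of_bool (c b = j)"
    "coeff (marked_term a b c) 1 = A j a b * of_bool (c a = j \<and> c b = j)"
    "coeff (marked_term a b c) 2 = - (of_bool (a = b) * (of_bool (c b = j) * edge_weight c)) +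
      (\<Sum>l<n. (A j a l * A j l b) * of_bool (c a = j \<and> c b = j \<and> c l = j))"
proof -
  let ?S = "colour_class n c j"
  define P where "P = (\<Prod>i\<in>K - {j}. rev_det n (A i) (colour_class n c i))"
  define X where "X = rev_adj n (A j) ?S a b"
  have P: "coeff P 0 = 1" "coeff P 1 = 0"
    "coeff P 2 = (\<Sum>i\<in>K - {j}. coeff (rev_det n (A i) (colour_class n c i)) 2)"
    unfolding P_def by (rule coeff_colour_product, blast)+
  \<comment> \<open>On the diagonal the adjugate carries the t^2 coefficient of the j-th
    determinant. Together with the other factors this restores the edge weight of the whole
    colouring, independently of \<open>b\<close>.\<close>
  have "coeff (rev_det n (A j) ?S) 2 + coeff P 2 = - edge_weight c"
    unfolding P(3) coeff_colour_product_2[symmetric] coeff_colour_product(3)[OF order.refl]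
    using fin j by (simp add: sum.remove)
  then have P2: "coeff (rev_det n (A j) ?S) 2 = - edge_weight c - coeff P 2"
    by (simp only: eq_diff_eq)
  have XP: "coeff (X * P) 0 = coeff X 0" "coeff (X * P) 1 = coeff X 1"
    "coeff (X * P) 2 = coeff X 2 + coeff X 0 * coeff P 2"
    using P(1,2) by (simp_all add: coeff_mult numeral_2_eq_2)
  have "coeff (marked_term a b c) 0 = of_bool (a = b) * of_bool (c b = j) \<and>
    coeff (marked_term a b c) 1 = A j a b * of_bool (c a = j \<and> c b = j) \<and>
    coeff (marked_term a b c) 2 = - (of_bool (a = b) * (of_bool (c b = j) * edge_weight c)) +
      (\<Sum>l<n. (A j a l * A j l b) * of_bool (c a = j \<and> c b = j \<and> c l = j))"
  proof (cases "c b = j")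
    case True
    then have b: "b \<in> ?S" and m: "marked_term a b c = X * P"
      using assms by (auto simp: colour_class_def marked_term_def X_def P_def)
    show ?thesis
    proof (cases "c a = j")
      case a: True
      then have "a \<in> ?S" using assms by (simp add: colour_class_def)
      note ab = colour_class_subset this b
      have "coeff X 0 = of_bool (a = b)" "coeff X 1 = A j a b"
        "coeff X 2 = (if a = b then coeff (rev_det n (A j) ?S) 2 else 0) + (\<Sum>l\<in>?S. A j a l * A j l b)"
        unfolding X_def by (rule coeff_rev_adj_0[OF ab] coeff_rev_adj_1[OF zero_diag[OF j] ab] coeff_rev_adj_2[OF zero_diag[OF j] ab]; assumption?)+
      moreover have "(\<Sum>l\<in>?S. A j a l * A j l b) = (\<Sum>l<n. (A j a l * A j l b) * of_bool (c a = j \<and> c b = j \<and> c l = j))"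
        using True a by (intro sum.mono_neutral_cong_left) (auto simp: colour_class_def)
      ultimately show ?thesis unfolding m XP using True a by (auto simp: P2)
    next
      case False
      then have "a \<notin> ?S" "a \<noteq> b" using True by (auto simp: colour_class_def)
      then have "X = 0" unfolding X_def
        using rev_adj_outside assms b by blast
      then show ?thesis unfolding m using False True \<open>a \<noteq> b\<close> by simp
    qed
  qed (simp add: marked_term_def)
  then show "coeff (marked_term a b c) 0 = of_bool (a = b) * of_bool (c b = j)"
    "coeff (marked_term a b c) 1 = A j a b * of_bool (c a = j \<and> c b = j)"
    "coeff (marked_term a b c) 2 = - (of_bool (a = b) * (of_bool (c b = j) * edge_weight c)) +
      (\<Sum>l<n. (A j a l * A j l b) * of_bool (c a = j \<and> c b = j \<and> c l = j))" by blast+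
qed

text \<open>By \<open>colour_mean_triple_defect\<close> only pairs containing \<open>b\<close>
  remain. The cases u = b and v = b contribute equally, which cancels the division by 2, and only i
  = j gets the weight k.\<close>

lemma edge_weight_defect:
  assumes "b < n"
  shows "of_nat (card K) * colour_mean n K (\<lambda>c. of_bool (c b = j) * edge_weight c) - colour_mean n K edge_weight
    = (1 / of_nat (card K))\<^sup>2 * (of_nat (card K) * (\<Sum>l<n. A j b l * A j l b) - (\<Sum>i\<in>K. \<Sum>l<n. A i b l * A i l b))"
proof -
  let ?k = "of_nat (card K) :: complex"
  let ?p = "1 / ?k"
  let ?B = "\<lambda>i u v. A i u v * A i v u"
  have "colour_mean n K (\<lambda>c. of_bool (c b = j) * edge_weight c)
    = colour_mean n K (\<lambda>c. \<Sum>i\<in>K. \<Sum>u<n. \<Sum>v<n. (?B i u v / 2) * of_bool (c b = j \<and> c u = i \<and> c v = i))"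
    unfolding edge_weight_def sum_distrib_left by (intro colour_mean_cong sum.cong refl) auto
  also have "\<dots> = (\<Sum>i\<in>K. \<Sum>u<n. \<Sum>v<n. (?B i u v / 2) * colour_mean n K (\<lambda>c. of_bool (c b = j \<and> c u = i \<and> c v = i)))"
    by (simp only: colour_mean_sum colour_mean_mult)
  finally have 1: "colour_mean n K (\<lambda>c. of_bool (c b = j) * edge_weight c) = \<dots>" .
  have 2: "colour_mean n K edge_weight = (\<Sum>i\<in>K. \<Sum>u<n. \<Sum>v<n. (?B i u v / 2) * colour_mean n K (\<lambda>c. of_bool (c u = i \<and> c v = i)))"
    unfolding edge_weight_def by (simp only: colour_mean_sum colour_mean_mult)
  have "?k * colour_mean n K (\<lambda>c. of_bool (c b = j) * edge_weight c) - colour_mean n K edge_weight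
    = (\<Sum>i\<in>K. \<Sum>u<n. \<Sum>v<n. (?B i u v / 2) * (?k * colour_mean n K (\<lambda>c. of_bool (c b = j \<and> c u = i \<and> c v = i))
        - colour_mean n K (\<lambda>c. of_bool (c u = i \<and> c v = i))))"
    unfolding 1 2 sum_distrib_left sum_subtractf[symmetric]
    by (rule sum.cong[OF refl], rule sum.cong[OF refl], rule sum.cong[OF refl]) (simp only: right_diff_distrib mult_ac)
  also have "\<dots> = (\<Sum>i\<in>K. \<Sum>u<n. \<Sum>v<n. (?B i u v / 2) * ((?k * of_bool (i = j) - 1) * ?p\<^sup>2 * (of_bool (u = b) + of_bool (v = b))))"
  proof (rule sum.cong[OF refl], rule sum.cong[OF refl], rule sum.cong[OF refl])
    fix i u v assume "i \<in> K" "u \<in> {..<n}" "v \<in> {..<n}"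
    then show "(?B i u v / 2) * (?k * colour_mean n K (\<lambda>c. of_bool (c b = j \<and> c u = i \<and> c v = i))
        - colour_mean n K (\<lambda>c. of_bool (c u = i \<and> c v = i)))
      = (?B i u v / 2) * ((?k * of_bool (i = j) - 1) * ?p\<^sup>2 * (of_bool (u = b) + of_bool (v = b)))"
      using zero_diag[of i u] colour_mean_triple_defect[OF fin _ j, of i u n v b] assms
      by (cases "u = v") auto
  qed
  also have "\<dots> = (\<Sum>i\<in>K. (?k * of_bool (i = j) - 1) * ?p\<^sup>2 * (\<Sum>l<n. ?B i b l))"
  proof (rule sum.cong[OF refl])
    fix i
    have delta: "(\<Sum>u<n. g u * of_bool (u = b)) = g b" for g :: "nat \<Rightarrow> complex" using assms by simp
    let ?z = "(?k * of_bool (i = j) - 1) * ?p\<^sup>2"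
    have "(\<Sum>u<n. \<Sum>v<n. (?B i u v / 2) * (?z * (of_bool (u = b) + of_bool (v = b))))
      = (\<Sum>u<n. (\<Sum>v<n. ?B i u v / 2 * ?z) * of_bool (u = b)) + (\<Sum>u<n. \<Sum>v<n. (?B i u v / 2 * ?z) * of_bool (v = b))"
      unfolding sum_distrib_right sum.distrib[symmetric]
      by (rule sum.cong[OF refl], rule sum.cong[OF refl]) (simp only: distrib_left distrib_right mult_ac)
    also have "\<dots> = (\<Sum>v<n. ?B i b v / 2 * ?z) + (\<Sum>u<n. ?B i u b / 2 * ?z)"
      by (simp only: delta)
    also have "\<dots> = ?z * (\<Sum>l<n. ?B i b l)"
      unfolding sum.distrib[symmetric] sum_distrib_left
      by (rule sum.cong[OF refl]) (simp add: field_simps)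
    finally show "(\<Sum>u<n. \<Sum>v<n. (?B i u v / 2) * (?z * (of_bool (u = b) + of_bool (v = b)))) = ?z * (\<Sum>l<n. ?B i b l)" .
  qed
  also have "\<dots> = (\<Sum>i\<in>K. (?k * ?p\<^sup>2 * (\<Sum>l<n. ?B i b l)) * of_bool (i = j)) - (\<Sum>i\<in>K. ?p\<^sup>2 * (\<Sum>l<n. ?B i b l))"
    unfolding sum_subtractf[symmetric] by (rule sum.cong[OF refl]) (simp add: algebra_simps)
  also have "\<dots> = ?p\<^sup>2 * (?k * (\<Sum>l<n. ?B j b l) - (\<Sum>i\<in>K. \<Sum>l<n. ?B i b l))"
  proof -
    have delta: "(\<Sum>i\<in>K. g i * of_bool (i = j)) = g j" for g :: "nat \<Rightarrow> complex" using fin j by simp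
    show ?thesis unfolding delta sum_distrib_left[symmetric] right_diff_distrib by (simp only: mult_ac)
  qed
  finally show ?thesis .
qed

text \<open>These are the moments up to k^n. Subtracting \<open>coeff q 2\<close> when a = b
  accounts for the t^2 term of the denominator multiplied by the zeroth moment I.\<close>

lemma marked_dets_reverse_coeffs:
  assumes "a < n" "b < n"
  defines "N \<equiv> marked_dets n K j (\<lambda>i. reverse_pencil (A i)) a b"
    and "q \<equiv> colour_dets n K (\<lambda>i. reverse_pencil (A i))" and "k \<equiv> of_nat (card K)"
  shows "k * coeff N 0 = k ^ n * of_bool (a = b)"
    "k * coeff N 1 = k ^ n * (A j a b / k)"
    "k * coeff N 2 - of_bool (a = b) * coeff q 2 =
      k ^ n * (((\<Sum>l<n. A j a l * A j l b) + of_bool (a = b) * (\<Sum>i\<in>K - {j}. \<Sum>l<n. A i b l * A i l b)) / k\<^sup>2)"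
proof -
  have k: "k \<noteq> 0" using fin j unfolding k_def by auto
  have N: "N = (\<Sum>c\<in>{..<n} \<rightarrow>\<^sub>E K. marked_term a b c)"
    unfolding N_def marked_dets_def marked_term_def rev_det_def rev_adj_def ..
  have coeff: "coeff N m = k ^ n * colour_mean n K (\<lambda>c. coeff (marked_term a b c) m)" for m
    unfolding N coeff_sum colour_mean_def k_def[symmetric] using k by simp
  show "k * coeff N 0 = k ^ n * of_bool (a = b)"
    unfolding coeff coeff_marked_term[OF assms(1,2)] colour_mean_mult colour_mean_single[OF fin j assms(2)] k_def[symmetric]
    using k by simp
  show "k * coeff N 1 = k ^ n * (A j a b / k)"
  proof (cases "a = b")
    case True
    then show ?thesis
      unfolding coeff coeff_marked_term[OF assms(1,2)] colour_mean_mult using zero_diag[OF j assms(2)] by simp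
  next
    case False
    show ?thesis
      unfolding coeff coeff_marked_term[OF assms(1,2)] colour_mean_mult
        colour_mean_pair[OF fin j j assms(1,2) False] k_def[symmetric]
      using k by (simp add: power2_eq_square)
  qed
  have N2: "coeff N 2 = k ^ n * (- (of_bool (a = b) * colour_mean n K (\<lambda>c. of_bool (c b = j) * edge_weight c)) +
      (\<Sum>l<n. (A j a l * A j l b) * colour_mean n K (\<lambda>c. of_bool (c a = j \<and> c b = j \<and> c l = j))))"
    unfolding coeff coeff_marked_term[OF assms(1,2)]
    by (simp only: colour_mean_add colour_mean_minus colour_mean_mult colour_mean_sum)
  have q2: "coeff q 2 = - (k ^ n * colour_mean n K edge_weight)"
    unfolding q_def k_def by (rule colour_dets_reverse_coeffs)
  show "k * coeff N 2 - of_bool (a = b) * coeff q 2 =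
      k ^ n * (((\<Sum>l<n. A j a l * A j l b) + of_bool (a = b) * (\<Sum>i\<in>K - {j}. \<Sum>l<n. A i b l * A i l b)) / k\<^sup>2)"
  proof (cases "a = b")
    case True
    \<comment> \<open>With a = b only two distinct indices must have colour \<open>j\<close>, so the
      mean is 1 / k^2; l = b drops out because of the zero diagonal. After multiplication by k this
      term cancels against the k-fold term in \<open>edge_weight_defect\<close>.\<close>
    have "(\<Sum>l<n. (A j a l * A j l b) * colour_mean n K (\<lambda>c. of_bool (c a = j \<and> c b = j \<and> c l = j)))
      = (\<Sum>l<n. (A j b l * A j l b) * (1 / k)\<^sup>2)"
    proof (rule sum.cong[OF refl])
      fix l assume "l \<in> {..<n}"
      then show "(A j a l * A j l b) * colour_mean n K (\<lambda>c. of_bool (c a = j \<and> c b = j \<and> c l = j)) = (A j b l * A j l b) * (1 / k)\<^sup>2"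
        using True zero_diag[OF j assms(2)] colour_mean_pair[OF fin j j assms(2), of l] unfolding k_def
        by (cases "l = b") auto
    qed
    also have "\<dots> = (\<Sum>l<n. A j b l * A j l b) * (1 / k)\<^sup>2" by (rule sum_distrib_right[symmetric])
    finally have 3: "(\<Sum>l<n. (A j a l * A j l b) * colour_mean n K (\<lambda>c. of_bool (c a = j \<and> c b = j \<and> c l = j)))
      = (\<Sum>l<n. A j b l * A j l b) * (1 / k)\<^sup>2" .
    have 4: "(\<Sum>i\<in>K. \<Sum>l<n. A i b l * A i l b) = (\<Sum>l<n. A j b l * A j l b) + (\<Sum>i\<in>K - {j}. \<Sum>l<n. A i b l * A i l b)"
      using fin j by (rule sum.remove)
    have "k * coeff N 2 - of_bool (a = b) * coeff q 2 = k ^ n * (k * ((\<Sum>l<n. A j b l * A j l b) * (1 / k)\<^sup>2)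
       - (k * colour_mean n K (\<lambda>c. of_bool (c b = j) * edge_weight c) - colour_mean n K edge_weight))"
      unfolding N2 q2 3 using True by (simp add: algebra_simps)
    also have "\<dots> = k ^ n * ((1 / k)\<^sup>2 * (\<Sum>i\<in>K. \<Sum>l<n. A i b l * A i l b))"
      unfolding edge_weight_defect[OF assms(2), folded k_def] by (simp add: algebra_simps)
    finally show ?thesis unfolding 4 using True by (simp add: power_divide)
  next
    case False
    \<comment> \<open>Off the diagonal three distinct indices must have colour \<open>j\<close>; the
      cases l = a and l = b vanish by the zero diagonal.\<close>
    have "(\<Sum>l<n. (A j a l * A j l b) * colour_mean n K (\<lambda>c. of_bool (c a = j \<and> c b = j \<and> c l = j)))
      = (\<Sum>l<n. (A j a l * A j l b) * (1 / k) ^ 3)"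
    proof (rule sum.cong[OF refl])
      fix l assume "l \<in> {..<n}"
      then show "(A j a l * A j l b) * colour_mean n K (\<lambda>c. of_bool (c a = j \<and> c b = j \<and> c l = j)) = (A j a l * A j l b) * (1 / k) ^ 3"
        using False zero_diag[OF j assms(2)] zero_diag[OF j assms(1)]
          colour_mean_triple[OF fin j j assms(2) _ assms(1), of l] unfolding k_def
        by (cases "l = b \<or> l = a") auto
    qed
    also have "\<dots> = (\<Sum>l<n. A j a l * A j l b) * (1 / k) ^ 3" by (rule sum_distrib_right[symmetric])
    finally have 3: "(\<Sum>l<n. (A j a l * A j l b) * colour_mean n K (\<lambda>c. of_bool (c a = j \<and> c b = j \<and> c l = j)))
      = (\<Sum>l<n. A j a l * A j l b) * (1 / k) ^ 3" .
    show ?thesis unfolding N2 q2 3 using False k by (simp add: power2_eq_square power3_eq_cube)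
  qed
qed

end

section \<open>Weights from residues\<close>

lemma poly_eq_of_cofinite:
  fixes p q :: "complex poly"
  assumes "finite E" "\<And>t. t \<notin> E \<Longrightarrow> poly p t = poly q t"
  shows "p = q"
proof (rule ccontr)
  assume "p \<noteq> q"
  then have "finite {t. poly (p - q) t = 0}" by (intro poly_roots_finite) simp
  moreover have "- E \<subseteq> {t. poly (p - q) t = 0}" using assms(2) by auto
  moreover have "infinite (- E)" using assms(1) by (simp add: Compl_eq_Diff_UNIV infinite_UNIV_char_0)
  ultimately show False using finite_subset by blast
qed

text \<open>Comparing Taylor coefficients at 0: \<open>1 / (1 - l t) = 1 + l t + l\<^sup>2 t\<^sup>2 + l\<^sup>3 t\<^sup>3 / (1 - l t)\<close>.\<close>

lemma moments_of_partial_fractions: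
  fixes P Q :: "complex poly" and w :: "complex \<Rightarrow> complex"
  assumes L: "finite L" and E: "finite E"
    and eq: "\<And>t. t \<notin> E \<Longrightarrow> (\<forall>l\<in>L. 1 - l * t \<noteq> 0) \<and> poly P t = poly Q t * (\<Sum>l\<in>L. w l / (1 - l * t))"
  shows "coeff P 0 = coeff Q 0 * (\<Sum>l\<in>L. w l)"
    "coeff P 1 = coeff Q 0 * (\<Sum>l\<in>L. l * w l) + coeff Q 1 * (\<Sum>l\<in>L. w l)"
    "coeff P 2 = coeff Q 0 * (\<Sum>l\<in>L. l\<^sup>2 * w l) + coeff Q 1 * (\<Sum>l\<in>L. l * w l) + coeff Q 2 * (\<Sum>l\<in>L. w l)"
proof -
  define G where "G = (\<Prod>l\<in>L. [:1, - l:])"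
  define T where "T = (\<Sum>l\<in>L. smult (w l) [:1, l, l\<^sup>2:])"
  define F where "F = P - Q * T"
  define R where "R = Q * (\<Sum>l\<in>L. smult (w l * l ^ 3) (\<Prod>m\<in>L - {l}. [:1, - m:]))"
  \<comment> \<open>Clearing the common denominator \<open>G\<close> shows that the error
    \<open>F\<close> of the truncated series is t^3 times a polynomial over \<open>G\<close>; since
    \<open>G\<close> has constant term 1, the first three coefficients of \<open>F\<close>
    vanish.\<close>
  have "G * F = monom 1 3 * R"
  proof (rule poly_eq_of_cofinite[OF E])
    fix t assume "t \<notin> E"
    then have t: "1 - l * t \<noteq> 0" if "l \<in> L" for l using eq that by blast
    have G: "poly G t = (1 - l * t) * (\<Prod>m\<in>L - {l}. 1 - m * t)" if "l \<in> L" for l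
      unfolding G_def poly_prod using L that by (subst prod.remove[of _ l]) (auto simp: mult.commute)
    have "w l / (1 - l * t) - w l * (1 + l * t + l\<^sup>2 * t\<^sup>2) = w l * l ^ 3 * t ^ 3 / (1 - l * t)" if "l \<in> L" for l
      using t[OF that] by (simp add: field_simps power2_eq_square power3_eq_cube)
    then have "(\<Sum>l\<in>L. w l / (1 - l * t)) - poly T t = (\<Sum>l\<in>L. w l * l ^ 3 * t ^ 3 / (1 - l * t))"
      unfolding T_def poly_sum sum_subtractf[symmetric]
      by (intro sum.cong refl) (simp add: power2_eq_square algebra_simps)
    then have "poly F t = poly Q t * (\<Sum>l\<in>L. w l * l ^ 3 * t ^ 3 / (1 - l * t))"
      using eq[OF \<open>t \<notin> E\<close>] by (simp add: F_def flip: right_diff_distrib)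
    then have "poly (G * F) t = poly Q t * (\<Sum>l\<in>L. poly G t * (w l * l ^ 3 * t ^ 3 / (1 - l * t)))"
      by (simp add: sum_distrib_left mult.left_commute)
    also have "(\<Sum>l\<in>L. poly G t * (w l * l ^ 3 * t ^ 3 / (1 - l * t))) = (\<Sum>l\<in>L. t ^ 3 * (w l * l ^ 3 * (\<Prod>m\<in>L - {l}. 1 - m * t)))"
    proof (intro sum.cong refl)
      fix l assume l: "l \<in> L"
      show "poly G t * (w l * l ^ 3 * t ^ 3 / (1 - l * t)) = t ^ 3 * (w l * l ^ 3 * (\<Prod>m\<in>L - {l}. 1 - m * t))"
        unfolding G[OF l] using t[OF l] by simp
    qed
    also have "poly Q t * \<dots> = poly (monom 1 3 * R) t"
      by (simp add: R_def poly_monom poly_sum poly_prod sum_distrib_left mult_ac)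
    finally show "poly (G * F) t = poly (monom 1 3 * R) t" .
  qed
  then have z: "coeff (G * F) m = 0" if "m < 3" for m
    using that by (simp add: coeff_monom_mult)
  have "coeff G 0 = 1" unfolding G_def by (simp add: poly_prod flip: poly_0_coeff_0)
  then have F: "coeff F 0 = 0" "coeff F 1 = 0" "coeff F 2 = 0"
    using z[of 0] z[of 1] z[of 2] by (auto simp: coeff_mult numeral_2_eq_2)
  have "coeff T 0 = (\<Sum>l\<in>L. w l)" "coeff T 1 = (\<Sum>l\<in>L. l * w l)" "coeff T 2 = (\<Sum>l\<in>L. l\<^sup>2 * w l)"
    by (simp_all add: T_def coeff_sum numeral_2_eq_2 mult.commute)
  then show "coeff P 0 = coeff Q 0 * (\<Sum>l\<in>L. w l)"
    "coeff P 1 = coeff Q 0 * (\<Sum>l\<in>L. l * w l) + coeff Q 1 * (\<Sum>l\<in>L. w l)"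
    "coeff P 2 = coeff Q 0 * (\<Sum>l\<in>L. l\<^sup>2 * w l) + coeff Q 1 * (\<Sum>l\<in>L. l * w l) + coeff Q 2 * (\<Sum>l\<in>L. w l)"
    using F by (simp_all add: F_def coeff_mult numeral_2_eq_2)
qed

lemma poly_char_pencil: "(\<lambda>i a b. poly (char_pencil (A i) a b) x) = (\<lambda>i a b. x * of_bool (a = b) - A i a b)"
  by (intro ext) (simp add: char_pencil_def)

text \<open>The lower half-plane is reduced to the upper one by changing the signs of x and of all
  matrices, which multiplies the sum by (-1)^n.\<close>

lemma colour_dets_roots_real:
  assumes "finite K" "K \<noteq> {}"
    and H: "\<And>i a b. i \<in> K \<Longrightarrow> a < n \<Longrightarrow> b < n \<Longrightarrow> A i b a = cnj (A i a b)"
    and root: "poly (colour_dets n K (\<lambda>i. char_pencil (A i))) x = 0"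
  shows "Im x = 0"
proof (rule ccontr)
  assume "Im x \<noteq> 0"
  then consider "Im x > 0" | "Im (- x) > 0" by fastforce
  then show False
  proof cases
    case 1
    from colour_dets_pencil_nonzero[OF assms(1,2) this H]
    show False using root unfolding poly_colour_dets poly_char_pencil by simp
  next
    case 2
    have "- A i b a = cnj (- A i a b)" if "i \<in> K" "a < n" "b < n" for i a b
      using H[OF that] by simp
    from colour_dets_pencil_nonzero[OF assms(1,2) 2, where H = "\<lambda>i a b. - A i a b", OF this]
    have "colour_dets n K (\<lambda>i a b. - x * of_bool (a = b) - - A i a b) \<noteq> 0" by simp
    moreover have "colour_dets n K (\<lambda>i a b. x * of_bool (a = b) - A i a b) =
      (- 1) ^ n * colour_dets n K (\<lambda>i a b. - x * of_bool (a = b) - - A i a b)"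
      unfolding colour_dets_scale[OF assms(1), symmetric] by simp
    ultimately show False using root unfolding poly_colour_dets poly_char_pencil by simp
  qed
qed

lemma matrix_weights_exist:
  fixes A :: "nat \<Rightarrow> nat \<Rightarrow> nat \<Rightarrow> complex"
  assumes fin: "finite K" and j: "j \<in> K"
    and H: "\<And>i a b. i \<in> K \<Longrightarrow> a < n \<Longrightarrow> b < n \<Longrightarrow> A i b a = cnj (A i a b)"
    and zero_diag: "\<And>i a. i \<in> K \<Longrightarrow> a < n \<Longrightarrow> A i a a = 0"
    and deg: "degree (colour_dets n K (\<lambda>i. char_pencil (A i))) = n"
  defines "q \<equiv> colour_dets n K (\<lambda>i. char_pencil (A i))" and "k \<equiv> of_nat (card K)"
  obtains w where
    "\<And>l v. poly q l = 0 \<Longrightarrow> Im (herm_form n (w l) v) = 0"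
    "\<And>l v. poly q l = 0 \<Longrightarrow> Re (herm_form n (w l) v) \<ge> 0"
    "\<And>a b. a < n \<Longrightarrow> b < n \<Longrightarrow> (\<Sum>l | poly q l = 0. w l a b) = of_bool (a = b)"
    "\<And>a b. a < n \<Longrightarrow> b < n \<Longrightarrow> (\<Sum>l | poly q l = 0. l * w l a b) = A j a b / k"
    "\<And>a b. a < n \<Longrightarrow> b < n \<Longrightarrow> (\<Sum>l | poly q l = 0. l\<^sup>2 * w l a b) =
      ((\<Sum>l<n. A j a l * A j l b) + of_bool (a = b) * (\<Sum>i\<in>K - {j}. \<Sum>l<n. A i b l * A i l b)) / k\<^sup>2"
proof -
  have ne: "K \<noteq> {}" using j by auto
  have k: "k \<noteq> 0" using fin j unfolding k_def by auto
  define N where "N a b = smult k (marked_dets n K j (\<lambda>i. char_pencil (A i)) a b)" for a b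
  define w where "w l a b = simple_residue (N a b) q l" for l a b
  \<comment> \<open>Any nonreal point would do: real-rootedness, as an implication, already excludes
    q = 0.\<close>
  have "poly q \<i> \<noteq> 0"
    using colour_dets_roots_real[where n = n and A = A and x = \<i>, OF fin ne H] unfolding q_def by fastforce
  then have q0: "q \<noteq> 0" by auto
  have Ndeg: "degree (N a b) < degree q" if "a < n" "b < n" for a b
    using degree_marked_dets[OF fin j that] deg unfolding N_def q_def
    by (intro le_less_trans[OF degree_smult_le]) simp
  have real: "Im l = 0" if "poly q l = 0" for l
    using colour_dets_roots_real[where n = n and A = A and x = l, OF fin ne H] that unfolding q_def by blast
  have im: "Im (herm_form n (\<lambda>a b. poly (N a b) x) v / poly q x) \<le> 0" if x: "Im x > 0" for v x
  proof -
    have "herm_form n (\<lambda>a b. poly (N a b) x) v / poly q x = of_nat (card K) *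
        (herm_form n (marked_dets n K j (\<lambda>i a b. x * of_bool (a = b) - A i a b)) v /
         colour_dets n K (\<lambda>i a b. x * of_bool (a = b) - A i a b))"
      unfolding N_def q_def poly_smult poly_marked_dets poly_colour_dets poly_char_pencil herm_form_def k_def
      by (simp add: sum_distrib_left mult_ac)
    moreover have "Im (of_nat m * z) = real m * Im z" for m z by simp
    ultimately show ?thesis using marked_dets_herglotz[where n = n and H = A and v = v, OF fin j x H]
      by (simp only: mult_nonneg_nonpos of_nat_0_le_iff)
  qed
  note residues = herglotz_matrix_residues[where q = q and N = N and n = n, OF q0]
  have res: "poly (N a b) x / poly q x = (\<Sum>l | poly q l = 0. w l a b / (x - l))"
    if "a < n" "b < n" "poly q x \<noteq> 0" for a b x
    unfolding w_def by (rule residues(1)) (use Ndeg real im that in blast)+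
  have res_Im: "Im (herm_form n (w l) v) = 0" if "poly q l = 0" for l v
    unfolding w_def by (rule residues(2)) (use Ndeg real im that in blast)+
  have res_Re: "Re (herm_form n (w l) v) \<ge> 0" if "poly q l = 0" for l v
    unfolding w_def by (rule residues(3)) (use Ndeg real im that in blast)+
  define P where "P a b = smult k (marked_dets n K j (\<lambda>i. reverse_pencil (A i)) a b)" for a b
  define Q where "Q = colour_dets n K (\<lambda>i. reverse_pencil (A i))"
  have finL: "finite {l. poly q l = 0}" using q0 by (rule poly_roots_finite)
  \<comment> \<open>Substituting x = 1 / t turns 1 / (x - l) into t / (1 - l t). Excluded are t = 0
    and the reciprocals of the roots; for the root 0 the convention \<open>inverse 0 = 0\<close>
    adds nothing new.\<close>
  have eq: "(\<forall>l\<in>{l. poly q l = 0}. 1 - l * t \<noteq> 0) \<and>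
      poly (P a b) t = poly Q t * (\<Sum>l | poly q l = 0. w l a b / (1 - l * t))"
    if t: "t \<notin> insert 0 (inverse ` {l. poly q l = 0})" and ab: "a < n" "b < n" for t a b
  proof
    have t0: "t \<noteq> 0" "1 / t \<noteq> 0" using t by auto
    have qt: "poly q (1 / t) \<noteq> 0"
    proof
      assume "poly q (1 / t) = 0"
      then have "inverse (1 / t) \<in> inverse ` {l. poly q l = 0}" by blast
      then show False using t by simp
    qed
    show ne: "\<forall>l\<in>{l. poly q l = 0}. 1 - l * t \<noteq> 0"
    proof
      fix l assume l: "l \<in> {l. poly q l = 0}"
      show "1 - l * t \<noteq> 0"
      proof
        assume "1 - l * t = 0"
        then have "l = 1 / t" using t0 by (simp add: field_simps)
        then show False using l qt by simp
      qed
    qed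
    have qQ: "poly q (1 / t) = (1 / t) ^ n * poly Q t"
      using poly_colour_dets_reverse[OF fin t0(2)] by (simp add: q_def Q_def)
    have "(1 / t) * poly (N a b) (1 / t) = k * ((1 / t) * poly (marked_dets n K j (\<lambda>i. char_pencil (A i)) a b) (1 / t))"
      by (simp add: N_def)
    also have "\<dots> = k * ((1 / t) ^ n * poly (marked_dets n K j (\<lambda>i. reverse_pencil (A i)) a b) (1 / (1 / t)))"
      by (simp only: poly_marked_dets_reverse[OF fin j ab(2) t0(2)])
    also have "\<dots> = (1 / t) ^ n * poly (P a b) t" by (simp add: P_def)
    finally have NP: "(1 / t) * poly (N a b) (1 / t) = (1 / t) ^ n * poly (P a b) t" .
    have "(1 / t) ^ n * poly (P a b) t = (1 / t) * (poly q (1 / t) * (\<Sum>l | poly q l = 0. w l a b / (1 / t - l)))"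
      unfolding NP[symmetric] res[OF ab qt, symmetric] using qt by simp
    also have "\<dots> = poly q (1 / t) * (\<Sum>l | poly q l = 0. (1 / t) * (w l a b / (1 / t - l)))"
      by (simp only: sum_distrib_left mult_ac)
    also have "(\<Sum>l | poly q l = 0. (1 / t) * (w l a b / (1 / t - l))) = (\<Sum>l | poly q l = 0. w l a b / (1 - l * t))"
    proof (intro sum.cong refl)
      fix l assume "l \<in> {l. poly q l = 0}"
      have "(1 / t) * (w l a b / (1 / t - l)) = w l a b / (t * (1 / t - l))" by simp
      also have "t * (1 / t - l) = 1 - l * t" using t0 by (simp add: algebra_simps)
      finally show "(1 / t) * (w l a b / (1 / t - l)) = w l a b / (1 - l * t)" .
    qed
    finally have "(1 / t) ^ n * poly (P a b) t = (1 / t) ^ n * (poly Q t * (\<Sum>l | poly q l = 0. w l a b / (1 - l * t)))"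
      unfolding qQ by (simp only: mult.assoc)
    then show "poly (P a b) t = poly Q t * (\<Sum>l | poly q l = 0. w l a b / (1 - l * t))"
      using t0 by simp
  qed
  have finE: "finite (insert 0 (inverse ` {l. poly q l = 0}))" using finL by simp
  have coeffs: "coeff Q 0 = k ^ n" "coeff Q 1 = 0"
    unfolding Q_def k_def
    by (rule colour_dets_reverse_coeffs(1)[where j = j] colour_dets_reverse_coeffs(2)[where j = j]; use fin j zero_diag in blast)+
  have cancel: "x = y" if "k ^ n * x = k ^ n * y" for x y using that k by simp
  show ?thesis
  proof (rule that)
    show "Im (herm_form n (w l) v) = 0" "Re (herm_form n (w l) v) \<ge> 0" if "poly q l = 0" for l v
      using res_Im res_Re that by blast+
    fix a b assume ab: "a < n" "b < n"
    note m = moments_of_partial_fractions[OF finL finE eq[OF _ ab], unfolded coeffs]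
    note c = marked_dets_reverse_coeffs[where A = A, OF fin j _ ab, OF zero_diag, folded Q_def k_def]
    show 1: "(\<Sum>l | poly q l = 0. w l a b) = of_bool (a = b)"
      using m(1) c(1) k by (simp add: P_def)
    have "k ^ n * (\<Sum>l | poly q l = 0. l * w l a b) = k ^ n * (A j a b / k)"
      using m(2) c(2) by (simp add: P_def)
    then show "(\<Sum>l | poly q l = 0. l * w l a b) = A j a b / k" by (rule cancel)
    have "k ^ n * (\<Sum>l | poly q l = 0. l\<^sup>2 * w l a b) = coeff (P a b) 2 - of_bool (a = b) * coeff Q 2"
      using m(3) 1 by (simp add: mult.commute)
    then have "k ^ n * (\<Sum>l | poly q l = 0. l\<^sup>2 * w l a b) = k ^ n * (((\<Sum>l<n. A j a l * A j l b) +
        of_bool (a = b) * (\<Sum>i\<in>K - {j}. \<Sum>l<n. A i b l * A i l b)) / k\<^sup>2)"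
      using c(3) by (simp add: P_def)
    then show "(\<Sum>l | poly q l = 0. l\<^sup>2 * w l a b) =
      ((\<Sum>l<n. A j a l * A j l b) + of_bool (a = b) * (\<Sum>i\<in>K - {j}. \<Sum>l<n. A i b l * A i l b)) / k\<^sup>2"
      by (rule cancel)
  qed
qed

text \<open>The entrywise real part is the mean of M and its entrywise conjugate, whose form at v is
  the conjugate of the form of M at the conjugate of v. Hence real and nonnegative forms stay
  so.\<close>

lemma herm_form_Re:
  "herm_form n (\<lambda>a b. of_real (Re (M a b))) v = (herm_form n M v + cnj (herm_form n M (\<lambda>a. cnj (v a)))) / 2"
proof -
  have "cnj (v a) * of_real (Re z) * v b = (cnj (v a) * z * v b + cnj (v a) * cnj z * v b) / 2" for a b z
    by (simp add: complex_eq_iff algebra_simps)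
  then show ?thesis
    unfolding herm_form_def cnj_sum sum.distrib[symmetric] sum_divide_distrib
    by (simp only: complex_cnj_mult complex_cnj_cnj)
qed

section \<open>Matrix form\<close>

text \<open>A colouring corresponds to the family of its classes; in the other direction
  disjointness and covering give each index a unique colour. Both sides consist of extensional
  functions, so \<open>restrict\<close> and the value \<open>undefined\<close> must match outside
  the domains.\<close>

lemma sum_ordered_partitions:
  "(\<Sum>S\<in>ordered_partitions n k. F S) = (\<Sum>c\<in>{..<n} \<rightarrow>\<^sub>E {1..k}. F (restrict (colour_class n c) {1..k}))"
proof (rule sum.reindex_bij_witness[of _ "\<lambda>c. restrict (colour_class n c) {1..k}"
    "\<lambda>S. \<lambda>a\<in>{..<n}. THE i. i \<in> {1..k} \<and> a \<in> S i"])
  fix S assume S: "S \<in> ordered_partitions n k"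
  define c where "c = (\<lambda>a\<in>{..<n}. THE i. i \<in> {1..k} \<and> a \<in> S i)"
  have ex: "\<exists>!i. i \<in> {1..k} \<and> a \<in> S i" if "a < n" for a
  proof (rule ex_ex1I)
    have U: "(\<Union>i\<in>{1..k}. S i) = {..<n}" using S unfolding ordered_partitions_def by blast
    have "a \<in> (\<Union>i\<in>{1..k}. S i)" unfolding U using that by simp
    then show "\<exists>i. i \<in> {1..k} \<and> a \<in> S i" by blast
    show "i = i'" if "i \<in> {1..k} \<and> a \<in> S i" "i' \<in> {1..k} \<and> a \<in> S i'" for i i'
      using S that unfolding ordered_partitions_def disjoint_family_on_def by blast
  qed
  have c: "c a \<in> {1..k} \<and> a \<in> S (c a)" if "a < n" for a
    using theI'[OF ex[OF that]] that by (simp add: c_def)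
  have c_eq: "c a = i" if "a < n" "i \<in> {1..k}" "a \<in> S i" for a i
    using ex[OF that(1)] c[OF that(1)] that by blast
  have SE: "S \<in> {1..k} \<rightarrow>\<^sub>E Pow {..<n}" using S by (simp add: ordered_partitions_def)
  have 1: "restrict (colour_class n c) {1..k} = S"
  proof
    fix i
    show "restrict (colour_class n c) {1..k} i = S i"
    proof (cases "i \<in> {1..k}")
      case True
      then have "S i \<subseteq> {..<n}" using SE by blast
      then have "colour_class n c i = S i"
        using c c_eq True by (auto simp: colour_class_def)
      then show ?thesis using True by simp
    next
      case False
      then have "S i = undefined" using SE by (rule PiE_arb[rotated])
      then show ?thesis unfolding restrict_def if_not_P[OF False] by simp
    qed
  qed
  then show "restrict (colour_class n (\<lambda>a\<in>{..<n}. THE i. i \<in> {1..k} \<and> a \<in> S i)) {1..k} = S"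
    by (simp only: c_def)
  show "(\<lambda>a\<in>{..<n}. THE i. i \<in> {1..k} \<and> a \<in> S i) \<in> {..<n} \<rightarrow>\<^sub>E {1..k}"
    unfolding c_def[symmetric] using c by (intro PiE_I) (auto simp: c_def)
  show "F (restrict (colour_class n (\<lambda>a\<in>{..<n}. THE i. i \<in> {1..k} \<and> a \<in> S i)) {1..k}) = F S"
    unfolding c_def[symmetric] 1 ..
next
  fix c assume c: "c \<in> {..<n} \<rightarrow>\<^sub>E {1..k}"
  show "restrict (colour_class n c) {1..k} \<in> ordered_partitions n k"
    unfolding ordered_partitions_def
  proof (intro CollectI conjI)
    show "restrict (colour_class n c) {1..k} \<in> {1..k} \<rightarrow>\<^sub>E Pow {..<n}"
      by (intro restrict_PiE_iff[THEN iffD2] ballI) (simp add: colour_class_subset)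
    show "disjoint_family_on (restrict (colour_class n c) {1..k}) {1..k}"
      by (auto simp: disjoint_family_on_def colour_class_def)
    have "c a \<in> {1..k}" if "a < n" for a using c that by blast
    then have "(\<Union>i\<in>{1..k}. colour_class n c i) = {..<n}" unfolding colour_class_def by blast
    then show "(\<Union>i\<in>{1..k}. restrict (colour_class n c) {1..k} i) = {..<n}"
      by (metis (no_types, lifting) SUP_cong restrict_apply')
  qed
  show "(\<lambda>a\<in>{..<n}. THE i. i \<in> {1..k} \<and> a \<in> restrict (colour_class n c) {1..k} i) = c"
  proof
    fix a
    show "(\<lambda>a\<in>{..<n}. THE i. i \<in> {1..k} \<and> a \<in> restrict (colour_class n c) {1..k} i) a = c a"
    proof (cases "a < n")
      case True
      have "c a \<in> {1..k}" using c True by blast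
      then have "(THE i. i \<in> {1..k} \<and> a \<in> restrict (colour_class n c) {1..k} i) = c a"
        using True by (intro the_equality) (simp_all add: colour_class_def split: if_splits)
      then show ?thesis using True by simp
    next
      case False
      then have "c a = undefined" using c by (intro PiE_arb[OF c]) simp
      then show ?thesis using False by simp
    qed
  qed
qed

text \<open>Each colouring contributes a monic polynomial of degree n, since the class sizes add up
  to n; the leading coefficient of the sum is therefore the number k^n of colourings.\<close>

lemma mixed_det_poly_colour_dets:
  assumes "\<And>i. i \<in> {1..k} \<Longrightarrow> A i \<in> carrier_mat n n"
  defines "q \<equiv> colour_dets n {1..k} (\<lambda>i. char_pencil (\<lambda>a b. A i $$ (a, b)))"
  shows "mixed_det_poly n k A = smult (1 / of_nat k ^ n) q"
    and "k \<noteq> 0 \<Longrightarrow> degree q = n"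
proof -
  define T where "T c = (\<Prod>i\<in>{1..k}. char_poly (submatrix (A i) (colour_class n c i) (colour_class n c i)))" for c
  have q: "q = (\<Sum>c\<in>{..<n} \<rightarrow>\<^sub>E {1..k}. T c)"
    unfolding q_def colour_dets_def T_def
    by (intro sum.cong prod.cong refl char_poly_submatrix(1)[symmetric] assms(1) colour_class_subset)
  have "(\<Sum>S\<in>ordered_partitions n k. \<Prod>i\<in>{1..k}. char_poly (submatrix (A i) (S i) (S i))) = q"
    unfolding sum_ordered_partitions q T_def by (intro sum.cong prod.cong refl) simp
  then show "mixed_det_poly n k A = smult (1 / of_nat k ^ n) q"
    by (simp add: mixed_det_poly_def)
  assume k: "k \<noteq> 0"
  have deg: "degree (T c) = n" and lead: "coeff (T c) n = 1" if c: "c \<in> {..<n} \<rightarrow>\<^sub>E {1..k}" for c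
  proof -
    note sub = char_poly_submatrix(2,3)[OF assms(1) colour_class_subset]
    have "degree (T c) = (\<Sum>i\<in>{1..k}. card (colour_class n c i))"
      unfolding T_def using sub by (subst degree_prod_eq_sum_degree) (auto intro!: sum.cong simp: leading_coeff_0_iff[symmetric] simp del: leading_coeff_0_iff)
    then show d: "degree (T c) = n" using sum_card_colour_class[OF _ c] by simp
    have "lead_coeff (T c) = 1" unfolding T_def lead_coeff_prod using sub by simp
    then show "coeff (T c) n = 1" using d by simp
  qed
  have "degree q \<le> n" unfolding q using deg by (intro degree_sum_le) (auto simp: finite_PiE)
  moreover have "coeff q n = of_nat k ^ n" unfolding q coeff_sum using lead by (simp add: card_funcsetE)
  then have "n \<le> degree q" using k by (intro le_degree) simp
  ultimately show "degree q = n" by simp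
qed

section \<open>Hermitian and positive semidefinite matrices by entries\<close>

lemma mat_adjoint_index:
  assumes "A \<in> carrier_mat n n" "a < n" "b < n"
  shows "mat_adjoint A $$ (a, b) = conjugate (A $$ (b, a))"
  using assms unfolding mat_adjoint_def by (simp add: mat_of_rows_index)

lemma hermitian_mat_iff:
  "hermitian_mat n A \<longleftrightarrow> A \<in> carrier_mat n n \<and> (\<forall>a<n. \<forall>b<n. A $$ (b, a) = cnj (A $$ (a, b)))"
proof -
  have "mat_adjoint A = A \<longleftrightarrow> (\<forall>a<n. \<forall>b<n. A $$ (b, a) = cnj (A $$ (a, b)))" if A: "A \<in> carrier_mat n n"
  proof
    assume "mat_adjoint A = A"
    then show "\<forall>a<n. \<forall>b<n. A $$ (b, a) = cnj (A $$ (a, b))"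
      using mat_adjoint_index[OF A] by (metis conjugate_complex_def)
  next
    assume H: "\<forall>a<n. \<forall>b<n. A $$ (b, a) = cnj (A $$ (a, b))"
    show "mat_adjoint A = A"
    proof (rule eq_matI)
      fix a b assume "a < dim_row A" "b < dim_col A"
      then have "a < n" "b < n" using A by auto
      then show "mat_adjoint A $$ (a, b) = A $$ (a, b)"
        using mat_adjoint_index[OF A] H by (metis conjugate_complex_def)
    qed (use A in \<open>auto simp: mat_adjoint_def\<close>)
  qed
  then show ?thesis by (auto simp: hermitian_mat_def)
qed

lemma psd_matI:
  assumes "\<And>v. Im (herm_form n w v) = 0" "\<And>v. Re (herm_form n w v) \<ge> 0"
  shows "psd_mat n (mat n n (\<lambda>(a, b). w a b))"
  unfolding psd_mat_def
proof
  show "hermitian_mat n (mat n n (\<lambda>(a, b). w a b))"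
    unfolding hermitian_mat_iff
  proof (intro conjI allI impI)
    fix a b assume ab: "a < n" "b < n"
    show "mat n n (\<lambda>(a, b). w a b) $$ (b, a) = cnj (mat n n (\<lambda>(a, b). w a b) $$ (a, b))"
      using ab by simp (rule hermitian_of_real_form[OF assms(1) ab])
  qed simp
  show "\<forall>v\<in>carrier_vec n. 0 \<le> Re ((mat n n (\<lambda>(a, b). w a b) *\<^sub>v v) \<bullet>c v)"
  proof
    fix v :: "complex vec" assume v: "v \<in> carrier_vec n"
    have "(mat n n (\<lambda>(a, b). w a b) *\<^sub>v v) \<bullet>c v = herm_form n w (\<lambda>a. v $ a)"
      using v by (simp add: scalar_prod_def herm_form_def lessThan_atLeast0 sum_distrib_left sum_distrib_right mult_ac conjugate_complex_def)
    then show "0 \<le> Re ((mat n n (\<lambda>(a, b). w a b) *\<^sub>v v) \<bullet>c v)" using assms(2) by simp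
  qed
qed

theorem theorem3p1:
  fixes n k :: nat and A :: "nat \<Rightarrow> complex mat" and \<Lambda> :: "complex set"
  assumes herm: "\<And>i. i \<in> {1..k} \<Longrightarrow> hermitian_mat n (A i)"
    and zdiag: "\<And>i. i \<in> {1..k} \<Longrightarrow> zero_diagonal (A i)"
    and Lambda: "\<Lambda> = {x. poly (mixed_det_poly n k A) x = 0}"
  shows "\<forall>j\<in>{1..k}. \<exists>W :: complex \<Rightarrow> complex mat.
      (\<forall>l\<in>\<Lambda>. psd_mat n (W l)) \<and>
      mat_sum n W \<Lambda> = 1\<^sub>m n \<and>
      mat_sum n (\<lambda>l. l \<cdot>\<^sub>m W l) \<Lambda> = (1 / of_nat k) \<cdot>\<^sub>m A j \<and>
      mat_sum n (\<lambda>l. l\<^sup>2 \<cdot>\<^sub>m W l) \<Lambda> =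
        (1 / (of_nat k)\<^sup>2) \<cdot>\<^sub>m
          (A j ^\<^sub>m 2 + mat_sum n (\<lambda>i. diag_part (A i ^\<^sub>m 2)) ({1..k} - {j})) \<and>
      weighted_moment n \<Lambda> W 2 - weighted_moment n \<Lambda> W 1 ^\<^sub>m 2 =
        (1 / (of_nat k)\<^sup>2) \<cdot>\<^sub>m mat_sum n (\<lambda>i. diag_part (A i ^\<^sub>m 2)) ({1..k} - {j}) \<and>
      ((\<forall>i\<in>{1..k}. real_symmetric_mat n (A i)) \<longrightarrow> (\<forall>l\<in>\<Lambda>. real_symmetric_mat n (W l)))"
proof
  fix j assume j: "j \<in> {1..k}"
  then have k: "k \<noteq> 0" by auto
  have carr: "A i \<in> carrier_mat n n" if "i \<in> {1..k}" for i
    using herm[OF that] by (simp add: hermitian_mat_def)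
  define B where "B i a b = A i $$ (a, b)" for i a b
  have HB: "B i b a = cnj (B i a b)" if "i \<in> {1..k}" "a < n" "b < n" for i a b
    using herm[OF that(1)] that(2,3) unfolding hermitian_mat_iff B_def by blast
  have ZB: "B i a a = 0" if "i \<in> {1..k}" "a < n" for i a
    using zdiag[OF that(1)] carr[OF that(1)] that by (auto simp: zero_diagonal_def B_def)
  define q where "q = colour_dets n {1..k} (\<lambda>i. char_pencil (B i))"
  have q: "mixed_det_poly n k A = smult (1 / of_nat k ^ n) q" "degree q = n"
    using mixed_det_poly_colour_dets[of k A n] carr k unfolding q_def B_def by auto
  \<comment> \<open>The normalizing scalar is nonzero because \<open>j\<close> exists and hence k >
    0.\<close>
  have L: "\<Lambda> = {l. poly q l = 0}" using k by (simp add: Lambda q(1))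
  define s where "s a b = ((\<Sum>l<n. B j a l * B j l b) + of_bool (a = b) * (\<Sum>i\<in>{1..k} - {j}. \<Sum>l<n. B i b l * B i l b)) / (of_nat k)\<^sup>2" for a b
  have fin: "finite {1..k}" by simp
  obtain w0 where w0:
    "\<And>l v. l \<in> \<Lambda> \<Longrightarrow> Im (herm_form n (w0 l) v) = 0"
    "\<And>l v. l \<in> \<Lambda> \<Longrightarrow> Re (herm_form n (w0 l) v) \<ge> 0"
    "\<And>a b. a < n \<Longrightarrow> b < n \<Longrightarrow> (\<Sum>l\<in>\<Lambda>. w0 l a b) = of_bool (a = b)"
    "\<And>a b. a < n \<Longrightarrow> b < n \<Longrightarrow> (\<Sum>l\<in>\<Lambda>. l * w0 l a b) = B j a b / of_nat k"
    "\<And>a b. a < n \<Longrightarrow> b < n \<Longrightarrow> (\<Sum>l\<in>\<Lambda>. l\<^sup>2 * w0 l a b) = s a b"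
  proof (rule matrix_weights_exist[where A = B and n = n and K = "{1..k}" and j = j, folded q_def,
      unfolded card_atLeastAtMost diff_Suc_1])
    fix w0 :: "complex \<Rightarrow> nat \<Rightarrow> nat \<Rightarrow> complex"
    assume "\<And>l v. poly q l = 0 \<Longrightarrow> Im (herm_form n (w0 l) v) = 0"
      "\<And>l v. poly q l = 0 \<Longrightarrow> Re (herm_form n (w0 l) v) \<ge> 0"
      "\<And>a b. a < n \<Longrightarrow> b < n \<Longrightarrow> (\<Sum>l | poly q l = 0. w0 l a b) = of_bool (a = b)"
      "\<And>a b. a < n \<Longrightarrow> b < n \<Longrightarrow> (\<Sum>l | poly q l = 0. l * w0 l a b) = B j a b / of_nat k"
      "\<And>a b. a < n \<Longrightarrow> b < n \<Longrightarrow> (\<Sum>l | poly q l = 0. l\<^sup>2 * w0 l a b) =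
        ((\<Sum>l<n. B j a l * B j l b) + of_bool (a = b) * (\<Sum>i\<in>{1..k} - {j}. \<Sum>l<n. B i b l * B i l b)) / (of_nat k)\<^sup>2"
    then show thesis by (rule that[of w0, unfolded L s_def mem_Collect_eq])
  qed (rule fin j q(2) | (rule HB ZB; assumption))+
  have real: "Im l = 0" if "l \<in> \<Lambda>" for l
    using colour_dets_roots_real[where A = B and n = n and x = l, OF fin _ HB] that j unfolding L q_def by blast
  \<comment> \<open>One choice of weights must serve the final implication: \<open>w0\<close> itself
    in general, its entrywise real part if all matrices are real symmetric.\<close>
  obtain w where w:
    "\<And>l v. l \<in> \<Lambda> \<Longrightarrow> Im (herm_form n (w l) v) = 0"
    "\<And>l v. l \<in> \<Lambda> \<Longrightarrow> Re (herm_form n (w l) v) \<ge> 0"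
    "\<And>a b. a < n \<Longrightarrow> b < n \<Longrightarrow> (\<Sum>l\<in>\<Lambda>. w l a b) = of_bool (a = b)"
    "\<And>a b. a < n \<Longrightarrow> b < n \<Longrightarrow> (\<Sum>l\<in>\<Lambda>. l * w l a b) = B j a b / of_nat k"
    "\<And>a b. a < n \<Longrightarrow> b < n \<Longrightarrow> (\<Sum>l\<in>\<Lambda>. l\<^sup>2 * w l a b) = s a b"
    and w_real: "\<And>l a b. (\<forall>i\<in>{1..k}. real_symmetric_mat n (A i)) \<Longrightarrow> w l a b \<in> \<real>"
  proof (cases "\<forall>i\<in>{1..k}. real_symmetric_mat n (A i)")
    case False
    then show ?thesis using that[of w0] w0 by blast
  next
    case True
    define w where "w l a b = complex_of_real (Re (w0 l a b))" for l a b
    have form: "herm_form n (w l) v = (herm_form n (w0 l) v + cnj (herm_form n (w0 l) (\<lambda>a. cnj (v a)))) / 2" for l v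
      unfolding w_def by (rule herm_form_Re)
    have BR: "B i a b \<in> \<real>" if "i \<in> {1..k}" "a < n" "b < n" for i a b
      using True that by (simp add: B_def real_symmetric_mat_def)
    \<comment> \<open>Real parts commute with the moment sums because the roots are real; the
      prescribed values of the moments are real as well, so they do not change.\<close>
    have sum: "(\<Sum>l\<in>\<Lambda>. l ^ m * w l a b) = of_real (Re (\<Sum>l\<in>\<Lambda>. l ^ m * w0 l a b))" for m a b
      unfolding Re_sum of_real_sum
    proof (rule sum.cong[OF refl])
      fix l assume "l \<in> \<Lambda>"
      then have "l ^ m = of_real (Re l ^ m)" using real by (simp add: complex_eq_iff flip: of_real_power)
      then show "l ^ m * w l a b = of_real (Re (l ^ m * w0 l a b))" by (simp only: w_def) simp
    qed
    have transfer: "(\<Sum>l\<in>\<Lambda>. l ^ m * w l a b) = z"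
      if "(\<Sum>l\<in>\<Lambda>. l ^ m * w0 l a b) = z" "z \<in> \<real>" for m a b z
      unfolding sum that(1) using that(2) by (rule of_real_Re)
    have sR: "s a b \<in> \<real>" if "a < n" "b < n" for a b
      unfolding s_def using BR j that
      by (intro Reals_divide Reals_add Reals_mult sum_in_Reals Reals_power Reals_of_nat) auto
    show ?thesis
    proof (rule that[of w])
      show "Im (herm_form n (w l) v) = 0" if "l \<in> \<Lambda>" for l v
        unfolding form using w0(1)[OF that] by simp
      show "Re (herm_form n (w l) v) \<ge> 0" if "l \<in> \<Lambda>" for l v
        unfolding form using w0(2)[OF that] by simp
      fix a b assume ab: "a < n" "b < n"
      show "(\<Sum>l\<in>\<Lambda>. w l a b) = of_bool (a = b)" using transfer[of 0 a b "of_bool (a = b)"] w0(3)[OF ab] by simp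
      show "(\<Sum>l\<in>\<Lambda>. l * w l a b) = B j a b / of_nat k"
        using transfer[of 1 a b] w0(4)[OF ab] BR[OF j ab] by simp
      show "(\<Sum>l\<in>\<Lambda>. l\<^sup>2 * w l a b) = s a b"
        using transfer w0(5)[OF ab] sR[OF ab] by blast
    qed (simp add: w_def)
  qed
  define W where "W l = mat n n (\<lambda>(a, b). w l a b)" for l
  have sq: "(M ^\<^sub>m 2) $$ (a, b) = (\<Sum>l<n. M $$ (a, l) * M $$ (l, b))"
    if "M \<in> carrier_mat n n" "a < n" "b < n" for M :: "complex mat" and a b
    using that by (simp add: numeral_2_eq_2 scalar_prod_def lessThan_atLeast0)
  have diag: "mat_sum n (\<lambda>i. diag_part (A i ^\<^sub>m 2)) ({1..k} - {j}) $$ (a, b) =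
      of_bool (a = b) * (\<Sum>i\<in>{1..k} - {j}. \<Sum>l<n. B i b l * B i l b)" if ab: "a < n" "b < n" for a b
  proof -
    have "diag_part (A i ^\<^sub>m 2) $$ (a, b) = of_bool (a = b) * (\<Sum>l<n. B i b l * B i l b)" if "i \<in> {1..k} - {j}" for i
      using carr[of i] that ab sq[of "A i" b b] by (simp add: diag_part_def mat_diag_def B_def)
    then show ?thesis using ab by (simp add: mat_sum_def sum_distrib_left)
  qed
  have dim: "mat_sum n F X \<in> carrier_mat n n" for F :: "'x \<Rightarrow> complex mat" and X by (simp add: mat_sum_def)
  have m0: "mat_sum n W \<Lambda> = 1\<^sub>m n"
    by (rule eq_matI) (auto simp: mat_sum_def W_def w(3))
  have m1: "mat_sum n (\<lambda>l. l \<cdot>\<^sub>m W l) \<Lambda> = (1 / of_nat k) \<cdot>\<^sub>m A j"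
    by (rule eq_matI) (use carr[OF j] in \<open>auto simp: mat_sum_def W_def w(4) B_def\<close>)
  have m2: "mat_sum n (\<lambda>l. l\<^sup>2 \<cdot>\<^sub>m W l) \<Lambda> =
        (1 / (of_nat k)\<^sup>2) \<cdot>\<^sub>m (A j ^\<^sub>m 2 + mat_sum n (\<lambda>i. diag_part (A i ^\<^sub>m 2)) ({1..k} - {j}))"
    (is "_ = _ \<cdot>\<^sub>m (_ + ?D)")
  proof (rule eq_matI)
    fix a b assume "a < dim_row ((1 / (of_nat k)\<^sup>2) \<cdot>\<^sub>m (A j ^\<^sub>m 2 + ?D))" "b < dim_col ((1 / (of_nat k)\<^sup>2) \<cdot>\<^sub>m (A j ^\<^sub>m 2 + ?D))"
    then have ab: "a < n" "b < n" by (simp_all add: mat_sum_def)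
    have "mat_sum n (\<lambda>l. l\<^sup>2 \<cdot>\<^sub>m W l) \<Lambda> $$ (a, b) = s a b"
      using ab by (simp add: mat_sum_def W_def w(5))
    also have "\<dots> = ((1 / (of_nat k)\<^sup>2) \<cdot>\<^sub>m (A j ^\<^sub>m 2 + ?D)) $$ (a, b)"
      using ab carr[OF j] dim[of "\<lambda>i. diag_part (A i ^\<^sub>m 2)" "{1..k} - {j}"] sq[OF carr[OF j] ab] diag[OF ab]
      by (simp add: s_def B_def)
    finally show "mat_sum n (\<lambda>l. l\<^sup>2 \<cdot>\<^sub>m W l) \<Lambda> $$ (a, b) = ((1 / (of_nat k)\<^sup>2) \<cdot>\<^sub>m (A j ^\<^sub>m 2 + ?D)) $$ (a, b)" .
  qed (simp_all add: mat_sum_def)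
  have h1: "weighted_moment n \<Lambda> W 1 = (1 / of_nat k) \<cdot>\<^sub>m A j"
    unfolding weighted_moment_def using m1 by simp
  have "weighted_moment n \<Lambda> W 2 - weighted_moment n \<Lambda> W 1 ^\<^sub>m 2 =
      (1 / (of_nat k)\<^sup>2) \<cdot>\<^sub>m mat_sum n (\<lambda>i. diag_part (A i ^\<^sub>m 2)) ({1..k} - {j})"
    unfolding h1 unfolding weighted_moment_def m2
  proof (rule eq_matI)
    let ?D = "mat_sum n (\<lambda>i. diag_part (A i ^\<^sub>m 2)) ({1..k} - {j})"
    fix a b assume "a < dim_row ((1 / (of_nat k)\<^sup>2) \<cdot>\<^sub>m ?D)" "b < dim_col ((1 / (of_nat k)\<^sup>2) \<cdot>\<^sub>m ?D)"
    then have ab: "a < n" "b < n" by (simp_all add: mat_sum_def)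
    have "(((1 / of_nat k) \<cdot>\<^sub>m A j) ^\<^sub>m 2) $$ (a, b) = (A j ^\<^sub>m 2) $$ (a, b) / (of_nat k)\<^sup>2"
      using carr[OF j] ab by (simp add: sq sum_divide_distrib power2_eq_square)
    then show "((1 / (of_nat k)\<^sup>2) \<cdot>\<^sub>m (A j ^\<^sub>m 2 + ?D) - ((1 / of_nat k) \<cdot>\<^sub>m A j) ^\<^sub>m 2) $$ (a, b) = ((1 / (of_nat k)\<^sup>2) \<cdot>\<^sub>m ?D) $$ (a, b)"
      using ab carr[OF j] dim[of "\<lambda>i. diag_part (A i ^\<^sub>m 2)" "{1..k} - {j}"]
      by (simp add: add_divide_distrib)
  qed (use carr[OF j] in \<open>simp_all add: mat_sum_def\<close>)
  moreover have "psd_mat n (W l)" if "l \<in> \<Lambda>" for l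
    unfolding W_def using w(1,2)[OF that] by (rule psd_matI)
  moreover have "real_symmetric_mat n (W l)" if "\<forall>i\<in>{1..k}. real_symmetric_mat n (A i)" "l \<in> \<Lambda>" for l
  proof -
    have "w l b a = w l a b" if "a < n" "b < n" for a b
      using hermitian_of_real_form[OF w(1)[OF \<open>l \<in> \<Lambda>\<close>] that] w_real[OF \<open>\<forall>i\<in>{1..k}. real_symmetric_mat n (A i)\<close>, of l a b]
      by (simp add: Reals_cnj_iff)
    then show ?thesis
      using w_real[OF that(1)] by (auto simp: real_symmetric_mat_def W_def intro!: eq_matI)
  qed
  ultimately show "\<exists>W :: complex \<Rightarrow> complex mat.
      (\<forall>l\<in>\<Lambda>. psd_mat n (W l)) \<and>
      mat_sum n W \<Lambda> = 1\<^sub>m n \<and>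
      mat_sum n (\<lambda>l. l \<cdot>\<^sub>m W l) \<Lambda> = (1 / of_nat k) \<cdot>\<^sub>m A j \<and>
      mat_sum n (\<lambda>l. l\<^sup>2 \<cdot>\<^sub>m W l) \<Lambda> =
        (1 / (of_nat k)\<^sup>2) \<cdot>\<^sub>m
          (A j ^\<^sub>m 2 + mat_sum n (\<lambda>i. diag_part (A i ^\<^sub>m 2)) ({1..k} - {j})) \<and>
      weighted_moment n \<Lambda> W 2 - weighted_moment n \<Lambda> W 1 ^\<^sub>m 2 =
        (1 / (of_nat k)\<^sup>2) \<cdot>\<^sub>m mat_sum n (\<lambda>i. diag_part (A i ^\<^sub>m 2)) ({1..k} - {j}) \<and>
      ((\<forall>i\<in>{1..k}. real_symmetric_mat n (A i)) \<longrightarrow> (\<forall>l\<in>\<Lambda>. real_symmetric_mat n (W l)))"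
    using m0 m1 m2 by blast
qed

end
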